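(* Let $(K,\nu)$ be a henselian valued field, $\bar K$ an algebraic closure of $K$, $\bar\nu$ the unique extension of $\nu$ to $\bar K$. Let $\bar\mu$ be a well-specified valuation of $\bar K[x]$ extending $\bar\nu$, associated with the closed ball $B=B(a,\bar\delta)$ of $\bar K$ (so $\bar\mu=\omega_{(a,\bar\delta)}$), and let $\mu$ be its restriction to $K[x]$. Then there exists a family $\mathcal A_{\bar\mu}=(\bar\mu_i)_{i\in I}$ of well-specified valuations of $\bar K[x]$, indexed by a totally ordered set $I$ with greatest element $\bar\iota$ and with $\bar\mu_{\bar\iota}=\bar\mu$, such that (1) the family $(\mu_i)_{i\in I}$ of the restrictions $\mu_i$ of $\bar\mu_i$ to $K[x]$ is an admitted family associated with $\mu$; (2) for $i\le j$ in $I$ one has $\bar\mu_i\le\bar\mu_j$, equivalently $B_j\subset B_i$, where $B_i$ is the closed ball associated with $\bar\mu_i$; thus $B_i=B(a,\delta_i)$ with $(\delta_i)_{i\in I}$ increasing; and which is obtained by the following descending construction, starting from $\bar\mu_{\bar\iota}=\bar\mu$. When the valuation $\bar\mu_i$ is known, consider $$R_K(\bar\mu_i)=\{\delta\in\Gamma_{\bar\nu}\ :\ \deg_K(B(a,\delta))<\deg_K(B(a,\delta_i))\}.$$ - If $R_K(\bar\mu_i)$ has a greatest element $\delta_{i-1}$, then $\bar\mu_{i-1}$ is the valuation associated with the ball $B(a,\delta_{i-1})$, and $i-1$ is the predecessor of $i$ in $I$. - If $R_K(\bar\mu_i)$ is nonempty without greatest element, one chooses a strictly increasing family $(\delta_\alpha)_{\alpha\in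 A}$ cofinal in $R_K(\bar\mu_i)$ ($A$ totally ordered without greatest element), on which $\deg_K(B(a,\delta_\alpha))$ is constant; the valuation $\bar\mu_{i_\alpha}$ is the one associated with $B(a,\delta_\alpha)$, and $I_A=(i_\alpha)_{\alpha\in A}$ is a subfamily of $I$ without greatest element, cofinal in $\{j\in I: j<i\}$; the construction then continues below $I_A$ using the set $\{\delta\in\Gamma_{\bar\nu}:\deg_K(B(a,\delta))<\deg_K(B(a,\delta_\alpha))\}$ (independent of $\alpha$). - The construction stops, i.e. the first valuation(s) of the family have been found, when a step produces balls with $\deg_K(B(a,\delta))=1$, where $\delta=\delta_{i-1}$ or $\delta=\delta_\alpha$ in the notation above.
   Context: Valuations are written additively. $\tilde\Gamma$ is a fixed totally ordered abelian group containing the value groups of $\nu$, $\bar\nu$ (the latter denoted $\Gamma_{\bar\nu}$) and of all valuations considered. For a valued field $(F,v)$, $a\in F$, $\delta\in\tilde\Gamma$: $\omega_{(a,\delta)}(\sum_j c_j(x-a)^j)=\min_j(v(c_j)+j\delta)$ on $F[x]$. For $a\in\bar K$: $B(a,\delta)=\{c\in\bar K:\bar\nu(a-c)\ge\delta\}$, considered with its radius. Since $\bar K$ is algebraically closed, the well-specified valuations of $\bar K[x]$ are exactly the $\omega_{(a,\delta)}$; $\omega_{(a,\delta)}$ is the valuation associated with $B(a,\delta)$. For $b\in\bar K$, $\deg_K(b)=[K(b):K]$, and for $E\subset\bar K$ nonempty, $\deg_K(E)=\min\{\deg_K(b):b\in E\}$. For valuations, $\mu\le\mu'$ means $\mu(f)\le\mu'(f)$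 for all $f$. Key polynomials (MacLane). Let $\mu$ be a valuation of $K[x]$. $f,g$ are $\mu$-equivalent if $\mu(f-g)>\mu(f)=\mu(g)$; $g$ $\mu$-divides $f$ if $f$ is $\mu$-equivalent to $gh$ for some $h$. A monic $\phi$ is a key polynomial for $\mu$ if it is $\mu$-irreducible (it does not $\mu$-divide $1$, and if it $\mu$-divides $fg$ it $\mu$-divides $f$ or $g$) and $\mu$-minimal (if $\phi$ $\mu$-divides $f\ne0$ then $\deg f\ge\deg\phi$). If $\gamma>\mu(\phi)$, the augmented valuation $\mu'=[\mu;\mu'(\phi)=\gamma]$ is $\mu'(\sum_j g_j\phi^j)=\min_j(\mu(g_j)+j\gamma)$, $\deg g_j<\deg\phi$. Continuous admissible family: $\mathcal C=(\mu_\alpha)_{\alpha\in A}$, $A$ totally ordered without greatest element, with $\mu_\alpha=[\mu;\mu_\alpha(\phi_\alpha)=\gamma_\alpha]$ for a fixed base valuation $\mu$ of $K[x]$ (possibly the first member), all $\phi_\alpha$ of the same degree $d$, $(\gamma_\alpha)$ strictly increasing, $\mu_\beta=[\mu_\alpha;\mu_\beta(\phi_\beta)=\gamma_\beta]$ for $\alpha<\beta$, and such that every element of $\tilde\Phi(\mathcal C)=\{f:\mu_\alpha(f)<\mu_\beta(f)\ \forall\alpha<\beta\}$ has degree $>d$. If $\tilde\Phi(\mathcal C)\ne\emptyset$, a limit key polynomial is a monic $\phi\in\tilde\Phi(\mathcal C)$ of minimal degree; for $\gamma>\mu_\alpha(\phi)$ for all $\alpha$, the limit augmented valuation $\mu'=[(\mu_\alpha)_\alpha;\mu'(\phi)=\gamma]$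 is $\mu'(\sum g_j\phi^j)=\min_j(\sup_\alpha\mu_\alpha(g_j)+j\gamma)$, $\deg g_j<\deg\phi$. Admissible family $(\mu_i)_{i\in I}$ of valuations of $K[x]$: a concatenation of simple families $\mathcal S^{(j)}=(\mathcal D^{(j)};\mathcal C^{(j)})$, $j\in J$, $J=\{1,\dots,N\}$ or $J=\mathbb N^*$, where $\mathcal D^{(j)}=(\mu_l)_{l\in L}$, $L=\{1,\dots,n\}$ or $\mathbb N^*$, is nonempty with $\mu_l=[\mu_{l-1};\mu_l(\phi_l)=\gamma_l]$ and $\deg\phi_l>\deg\phi_{l-1}$ for $l\ge2$; $\mathcal C^{(j)}$ is empty or, with $\mathcal D^{(j)}$ finite, is a continuous admissible family with base the last valuation $\mu_n$ of $\mathcal D^{(j)}$ and of degree $\deg\phi_n$; if $j$ is not the last index, $\mathcal D^{(j)}$ is finite, $\mathcal C^{(j)}$ is nonempty and the first valuation of $\mathcal S^{(j+1)}$ is a limit augmented valuation for $\mathcal C^{(j)}$; the first valuation of $\mathcal S^{(1)}$ is some $\omega_{(c,\gamma)}$, $c\in K$. $I$ carries the concatenation order. If $\mathcal S^{(j)}$ has a continuous part, a valuation of $\mathcal D^{(j)}$ of the same degree as the continuous part may be regarded as belonging to the continuous part. The family is admitted if for every $f\in K[x]$ the family $(\mu_i(f))_{i\in I}$ has a greatest element; it is associated with $\mu$ if $\mu(f)=\max_i\mu_i(f)$ for all $f\in K[x]$. *)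

theory Defs
  imports
    "HOL-Computational_Algebra.Polynomial"
    "HOL-Library.Extended"
    "HOL-Library.Lub_Glb"
begin

section \<open>Valuations\<close>

text \<open>
  The ordered group containing all value groups is the type \<open>'g\<close>; a valuation takes its values
  in \<open>'g extended\<close>, where \<open>-\<infinity>\<close> is excluded and \<open>\<infinity>\<close> is the value of 0 only.
\<close>

definition valuation :: "('r::idom \<Rightarrow> 'g::linordered_ab_group_add extended) \<Rightarrow> bool" where
  "valuation v \<longleftrightarrow>
     (\<forall>x. v x \<noteq> -\<infinity>) \<and> (\<forall>x. v x = \<infinity> \<longleftrightarrow> x = 0) \<and>
     (\<forall>x y. v (x * y) = v x + v y) \<and> (\<forall>x y. min (v x) (v y) \<le> v (x + y))"

definition value_group :: "('r::idom \<Rightarrow> 'g::linordered_ab_group_add extended) \<Rightarrow> 'g set" where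
  "value_group v = {g. \<exists>x. x \<noteq> 0 \<and> v x = Fin g}"

definition nat_times :: "nat \<Rightarrow> 'g::comm_monoid_add \<Rightarrow> 'g" where
  "nat_times n g = (\<Sum>_<n. g)"

text \<open>
  The coefficients \<open>c\<^sub>j\<close> of the expansion of \<open>f\<close> in powers of \<open>x - a\<close> are the coefficients of
  \<open>f(x + a)\<close>.
\<close>

definition omega ::
  "('f::field \<Rightarrow> 'g::linordered_ab_group_add extended) \<Rightarrow> 'f \<Rightarrow> 'g \<Rightarrow> 'f poly \<Rightarrow> 'g extended" where
  "omega v a \<delta> f = (MIN j\<in>{..degree f}. v (coeff (pcompose f [:a, 1:]) j) + Fin (nat_times j \<delta>))"

text \<open>Over an algebraically closed field the well-specified valuations are the \<open>omega v a \<delta>\<close>.\<close>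

definition well_specified ::
  "('l::alg_closed_field \<Rightarrow> 'g::linordered_ab_group_add extended) \<Rightarrow>
   ('l poly \<Rightarrow> 'g extended) \<Rightarrow> bool" where
  "well_specified v w \<longleftrightarrow> (\<exists>a \<delta>. w = omega v a \<delta>)"

definition vball ::
  "('f::field \<Rightarrow> 'g::linordered_ab_group_add extended) \<Rightarrow> 'f \<Rightarrow> 'g \<Rightarrow> 'f set" where
  "vball v a \<delta> = {c. v (a - c) \<ge> Fin \<delta>}"


section \<open>The field extension\<close>

definition algebraic_closure_embedding :: "('k::field \<Rightarrow> 'l::alg_closed_field) \<Rightarrow> bool" where
  "algebraic_closure_embedding emb \<longleftrightarrow>
     emb 1 = 1 \<and> (\<forall>x y. emb (x + y) = emb x + emb y) \<and> (\<forall>x y. emb (x * y) = emb x * emb y) \<and>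
     (\<forall>b. \<exists>p. p \<noteq> 0 \<and> poly (map_poly emb p) b = 0)"

definition restrict_poly ::
  "('k::field \<Rightarrow> 'l::field) \<Rightarrow> ('l poly \<Rightarrow> 'v) \<Rightarrow> 'k poly \<Rightarrow> 'v" where
  "restrict_poly emb w = (\<lambda>f. w (map_poly emb f))"

definition extends_valuation ::
  "('k::field \<Rightarrow> 'l::field) \<Rightarrow> ('k \<Rightarrow> 'v) \<Rightarrow> ('l \<Rightarrow> 'v) \<Rightarrow> bool" where
  "extends_valuation emb v w \<longleftrightarrow> (\<forall>x. w (emb x) = v x)"

text \<open>
  A valued field is henselian if its valuation extends uniquely to an algebraic closure, and hence
  to every algebraic extension. The codomain \<open>'g\<close> loses no generality: as soon as it contains the
  value group of one extension to the algebraic closure, all other extensions can be realised in it.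
\<close>

definition henselian ::
  "('k::field \<Rightarrow> 'l::alg_closed_field) \<Rightarrow>
   ('k \<Rightarrow> 'g::linordered_ab_group_add extended) \<Rightarrow> bool" where
  "henselian emb v \<longleftrightarrow> valuation v \<and> (\<exists>!w. valuation w \<and> extends_valuation emb v w)"

definition is_subfield :: "'l::field set \<Rightarrow> bool" where
  "is_subfield F \<longleftrightarrow> 0 \<in> F \<and> 1 \<in> F \<and>
     (\<forall>x\<in>F. \<forall>y\<in>F. x + y \<in> F \<and> x * y \<in> F) \<and> (\<forall>x\<in>F. - x \<in> F \<and> inverse x \<in> F)"

definition adjoin :: "('k::field \<Rightarrow> 'l::field) \<Rightarrow> 'l \<Rightarrow> 'l set" where
  "adjoin emb b = \<Inter>{F. is_subfield F \<and> range emb \<subseteq> F \<and> b \<in> F}"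

definition degK :: "('k::field \<Rightarrow> 'l::field) \<Rightarrow> 'l \<Rightarrow> nat" where
  "degK emb b = vector_space.dim (\<lambda>c y. emb c * y) (adjoin emb b)"

definition degK_set :: "('k::field \<Rightarrow> 'l::field) \<Rightarrow> 'l set \<Rightarrow> nat" where
  "degK_set emb E = Inf (degK emb ` E)"


section \<open>Key polynomials and augmented valuations\<close>

definition mu_equivalent ::
  "('k::field poly \<Rightarrow> 'g::linordered_ab_group_add extended) \<Rightarrow> 'k poly \<Rightarrow> 'k poly \<Rightarrow> bool" where
  "mu_equivalent \<mu> f g \<longleftrightarrow> \<mu> (f - g) > \<mu> f \<and> \<mu> f = \<mu> g"

definition mu_divides ::
  "('k::field poly \<Rightarrow> 'g::linordered_ab_group_add extended) \<Rightarrow> 'k poly \<Rightarrow> 'k poly \<Rightarrow> bool" where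
  "mu_divides \<mu> g f \<longleftrightarrow> (\<exists>h. mu_equivalent \<mu> f (g * h))"

definition mu_irreducible ::
  "('k::field poly \<Rightarrow> 'g::linordered_ab_group_add extended) \<Rightarrow> 'k poly \<Rightarrow> bool" where
  "mu_irreducible \<mu> \<phi> \<longleftrightarrow> \<not> mu_divides \<mu> \<phi> 1 \<and>
     (\<forall>f g. mu_divides \<mu> \<phi> (f * g) \<longrightarrow> mu_divides \<mu> \<phi> f \<or> mu_divides \<mu> \<phi> g)"

definition mu_minimal ::
  "('k::field poly \<Rightarrow> 'g::linordered_ab_group_add extended) \<Rightarrow> 'k poly \<Rightarrow> bool" where
  "mu_minimal \<mu> \<phi> \<longleftrightarrow> (\<forall>f. f \<noteq> 0 \<and> mu_divides \<mu> \<phi> f \<longrightarrow> degree f \<ge> degree \<phi>)"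

definition key_polynomial ::
  "('k::field poly \<Rightarrow> 'g::linordered_ab_group_add extended) \<Rightarrow> 'k poly \<Rightarrow> bool" where
  "key_polynomial \<mu> \<phi> \<longleftrightarrow> lead_coeff \<phi> = 1 \<and> mu_irreducible \<mu> \<phi> \<and> mu_minimal \<mu> \<phi>"

text \<open>\<open>augmented_valuation \<mu> \<phi> \<gamma> \<mu>'\<close> is \<open>\<mu>' = [\<mu>; \<mu>'(\<phi>) = \<gamma>]\<close>.\<close>

definition augmented_valuation ::
  "('k::field poly \<Rightarrow> 'g::linordered_ab_group_add extended) \<Rightarrow> 'k poly \<Rightarrow> 'g \<Rightarrow>
   ('k poly \<Rightarrow> 'g extended) \<Rightarrow> bool" where
  "augmented_valuation \<mu> \<phi> \<gamma> \<mu>' \<longleftrightarrow> key_polynomial \<mu> \<phi> \<and> \<mu> \<phi> < Fin \<gamma> \<and>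
     (\<forall>n g. (\<forall>j\<le>n. degree (g j) < degree \<phi>) \<longrightarrow>
        \<mu>' (\<Sum>j\<le>n. g j * \<phi> ^ j) = (MIN j\<in>{..n}. \<mu> (g j) + Fin (nat_times j \<gamma>)))"


section \<open>Continuous families and limit augmented valuations\<close>

text \<open>Families are functions on a linearly ordered type, considered on a subset of indices.\<close>

definition increasing_polys ::
  "'i::linorder set \<Rightarrow> ('i \<Rightarrow> 'k::field poly \<Rightarrow> 'g::linordered_ab_group_add extended) \<Rightarrow>
   'k poly set" where
  "increasing_polys A M = {f. \<forall>\<alpha>\<in>A. \<forall>\<beta>\<in>A. \<alpha> < \<beta> \<longrightarrow> M \<alpha> f < M \<beta> f}"

text \<open>The base valuation \<open>\<mu>\<close> is not a member of the family.\<close>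

definition continuous_admissible_family ::
  "('k::field poly \<Rightarrow> 'g::linordered_ab_group_add extended) \<Rightarrow> 'i::linorder set \<Rightarrow>
   ('i \<Rightarrow> 'k poly \<Rightarrow> 'g extended) \<Rightarrow> nat \<Rightarrow> bool" where
  "continuous_admissible_family \<mu> A M d \<longleftrightarrow>
     A \<noteq> {} \<and> (\<forall>\<alpha>\<in>A. \<exists>\<beta>\<in>A. \<alpha> < \<beta>) \<and>
     (\<exists>\<phi> \<gamma>.
        (\<forall>\<alpha>\<in>A. augmented_valuation \<mu> (\<phi> \<alpha>) (\<gamma> \<alpha>) (M \<alpha>) \<and> degree (\<phi> \<alpha>) = d) \<and>
        strict_mono_on A \<gamma> \<and>
        (\<forall>\<alpha>\<in>A. \<forall>\<beta>\<in>A. \<alpha> < \<beta> \<longrightarrow> augmented_valuation (M \<alpha>) (\<phi> \<beta>) (\<gamma> \<beta>) (M \<beta>))) \<and>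
     (\<forall>f\<in>increasing_polys A M. d < degree f)"

definition limit_key_polynomial ::
  "'i::linorder set \<Rightarrow> ('i \<Rightarrow> 'k::field poly \<Rightarrow> 'g::linordered_ab_group_add extended) \<Rightarrow>
   'k poly \<Rightarrow> bool" where
  "limit_key_polynomial A M \<phi> \<longleftrightarrow> lead_coeff \<phi> = 1 \<and> \<phi> \<in> increasing_polys A M \<and>
     (\<forall>f\<in>increasing_polys A M. degree \<phi> \<le> degree f)"

definition limit_augmented_valuation ::
  "'i::linorder set \<Rightarrow> ('i \<Rightarrow> 'k::field poly \<Rightarrow> 'g::linordered_ab_group_add extended) \<Rightarrow>
   'k poly \<Rightarrow> 'g \<Rightarrow> ('k poly \<Rightarrow> 'g extended) \<Rightarrow> bool" where
  "limit_augmented_valuation A M \<phi> \<gamma> \<mu>' \<longleftrightarrow>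
     limit_key_polynomial A M \<phi> \<and> (\<forall>\<alpha>\<in>A. M \<alpha> \<phi> < Fin \<gamma>) \<and>
     (\<forall>n g. (\<forall>j\<le>n. degree (g j) < degree \<phi>) \<longrightarrow>
        (\<exists>s. (\<forall>j\<le>n. isLub UNIV ((\<lambda>\<alpha>. M \<alpha> (g j)) ` A) (s j)) \<and>
             \<mu>' (\<Sum>j\<le>n. g j * \<phi> ^ j) = (MIN j\<in>{..n}. s j + Fin (nat_times j \<gamma>))))"


section \<open>Admissible families\<close>

definition index_range :: "nat set \<Rightarrow> bool" where
  "index_range L \<longleftrightarrow> (\<exists>n\<ge>1. L = {1..n}) \<or> L = {1..}"

text \<open>
  The \<open>j\<close>-th simple family consists of the discrete part \<open>M (e j l)\<close>, \<open>l \<in> L j\<close>, and of the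
  continuous part indexed by \<open>C j\<close>; the index set \<open>I\<close> is the ordered concatenation of these.
  The polynomials \<open>\<phi> j l\<close> are those defining the valuations of the discrete parts; \<open>\<phi> 1 1\<close> is
  \<open>x - c\<close>, and \<open>\<phi> (j + 1) 1\<close> is the limit key polynomial for the \<open>j\<close>-th continuous part.
\<close>

definition admissible_family ::
  "('k::field \<Rightarrow> 'g::linordered_ab_group_add extended) \<Rightarrow> 'i::linorder set \<Rightarrow>
   ('i \<Rightarrow> 'k poly \<Rightarrow> 'g extended) \<Rightarrow> bool" where
  "admissible_family v I M \<longleftrightarrow>
     (\<forall>i\<in>I. valuation (M i)) \<and>
     (\<exists>J L e C \<phi> \<gamma>.
        index_range J \<and>
        (\<forall>j\<in>J. index_range (L j)) \<and>
        I = (\<Union>j\<in>J. e j ` L j \<union> C j) \<and>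
        (\<forall>j\<in>J. strict_mono_on (L j) (e j)) \<and>
        (\<forall>j\<in>J. \<forall>l\<in>L j. \<forall>\<alpha>\<in>C j. e j l < \<alpha>) \<and>
        (\<forall>j\<in>J. \<forall>j'\<in>J. j < j' \<longrightarrow>
           (\<forall>x\<in>e j ` L j \<union> C j. \<forall>y\<in>e j' ` L j' \<union> C j'. x < y)) \<and>
        (\<exists>c. \<phi> 1 1 = [:- c, 1:] \<and> M (e 1 1) = omega v c (\<gamma> 1 1)) \<and>
        (\<forall>j\<in>J. \<forall>l. l \<in> L j \<and> Suc l \<in> L j \<longrightarrow>
           augmented_valuation (M (e j l)) (\<phi> j (Suc l)) (\<gamma> j (Suc l)) (M (e j (Suc l))) \<and>
           degree (\<phi> j l) < degree (\<phi> j (Suc l))) \<and>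
        (\<forall>j\<in>J. C j = {} \<or>
           finite (L j) \<and>
           continuous_admissible_family (M (e j (Max (L j)))) (C j) M (degree (\<phi> j (Max (L j))))) \<and>
        (\<forall>j\<in>J. Suc j \<in> J \<longrightarrow>
           finite (L j) \<and> C j \<noteq> {} \<and>
           limit_augmented_valuation (C j) M (\<phi> (Suc j) 1) (\<gamma> (Suc j) 1) (M (e (Suc j) 1))))"

definition admitted_family ::
  "('k::field \<Rightarrow> 'g::linordered_ab_group_add extended) \<Rightarrow> 'i::linorder set \<Rightarrow>
   ('i \<Rightarrow> 'k poly \<Rightarrow> 'g extended) \<Rightarrow> bool" where
  "admitted_family v I M \<longleftrightarrow> admissible_family v I M \<and> (\<forall>f. \<exists>i\<in>I. \<forall>j\<in>I. M j f \<le> M i f)"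

definition family_associated ::
  "'i::linorder set \<Rightarrow> ('i \<Rightarrow> 'k::field poly \<Rightarrow> 'g::linordered_ab_group_add extended) \<Rightarrow>
   ('k poly \<Rightarrow> 'g extended) \<Rightarrow> bool" where
  "family_associated I M \<mu> \<longleftrightarrow> (\<forall>f. \<exists>i\<in>I. \<mu> f = M i f \<and> (\<forall>j\<in>I. M j f \<le> M i f))"


section \<open>The descending construction\<close>

text \<open>
  \<open>R\<^sub>K\<close> depends on the ball \<open>B(a,\<delta>\<^sub>i)\<close> only through the degree \<open>d\<close> of the latter.
\<close>

definition RK ::
  "('k::field \<Rightarrow> 'l::alg_closed_field) \<Rightarrow> ('l \<Rightarrow> 'g::linordered_ab_group_add extended) \<Rightarrow> 'l \<Rightarrow>
   nat \<Rightarrow> 'g set" where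
  "RK emb w a d = {\<delta> \<in> value_group w. degK_set emb (vball w a \<delta>) < d}"

text \<open>
  \<open>descent emb w a I r U d\<close> says that \<open>U\<close> is the final segment of \<open>I\<close> obtained after finitely many
  steps of the construction, where \<open>r i\<close> is the radius of the ball indexed by \<open>i\<close>, and that the
  ball or balls produced by the last step have degree \<open>d\<close>. In rule \<open>limit\<close> the set \<open>S\<close> serves
  both as the index set of the chosen cofinal family of radii and as \<open>I\<^sub>A\<close>.
\<close>

inductive descent ::
  "('k::field \<Rightarrow> 'l::alg_closed_field) \<Rightarrow> ('l \<Rightarrow> 'g::linordered_ab_group_add extended) \<Rightarrow> 'l \<Rightarrow>
   'i::linorder set \<Rightarrow> ('i \<Rightarrow> 'g) \<Rightarrow> 'i set \<Rightarrow> nat \<Rightarrow> bool"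
  for emb w a I r where
  start:
    "\<lbrakk>m \<in> I; \<forall>i\<in>I. i \<le> m\<rbrakk> \<Longrightarrow> descent emb w a I r {m} (degK_set emb (vball w a (r m)))"
| predecessor:
    "\<lbrakk>descent emb w a I r U d;
      \<rho> \<in> RK emb w a d; \<forall>\<sigma>\<in>RK emb w a d. \<sigma> \<le> \<rho>;
      p \<in> I; r p = \<rho>; {j \<in> I. p < j} = U\<rbrakk>
     \<Longrightarrow> descent emb w a I r (insert p U) (degK_set emb (vball w a \<rho>))"
| limit:
    "\<lbrakk>descent emb w a I r U d;
      RK emb w a d \<noteq> {}; \<forall>\<rho>\<in>RK emb w a d. \<exists>\<sigma>\<in>RK emb w a d. \<rho> < \<sigma>;
      S \<subseteq> I - U; \<forall>s\<in>S. \<exists>t\<in>S. s < t;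
      strict_mono_on S r; r ` S \<subseteq> RK emb w a d; \<forall>\<rho>\<in>RK emb w a d. \<exists>s\<in>S. \<rho> \<le> r s;
      \<forall>s\<in>S. degK_set emb (vball w a (r s)) = d';
      \<forall>j\<in>I - U. \<exists>s\<in>S. j \<le> s; \<forall>j\<in>I. \<forall>s\<in>S. s \<le> j \<longrightarrow> j \<in> S \<union> U\<rbrakk>
     \<Longrightarrow> descent emb w a I r (S \<union> U) d'"

text \<open>The construction is complete when it has exhausted \<open>I\<close> and reached degree 1.\<close>

definition obtained_by_descent ::
  "('k::field \<Rightarrow> 'l::alg_closed_field) \<Rightarrow> ('l \<Rightarrow> 'g::linordered_ab_group_add extended) \<Rightarrow> 'l \<Rightarrow>
   'i::linorder set \<Rightarrow> ('i \<Rightarrow> 'g) \<Rightarrow> bool" where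
  "obtained_by_descent emb w a I r \<longleftrightarrow> descent emb w a I r I 1"

end

theory Submission
  imports Defs
begin

text \<open>
  Write \<open>D(\<delta>)\<close> for the degree over \<open>K\<close> of the ball \<open>B(a, \<delta>)\<close>, and \<open>\<omega>\<^sub>\<delta>\<close> for the restriction to
  \<open>K[x]\<close> of the valuation of this ball.

  The proof rests on one observation about division by a minimal polynomial. Let \<open>b\<close> be an element
  of minimal degree in \<open>B(a, \<delta>)\<close>, let \<open>\<phi>\<close> be its minimal polynomial over \<open>K\<close>, and let
  \<open>f = q \<phi> + r\<close> with \<open>deg r < deg \<phi>\<close>. The roots of \<open>r\<close> have smaller degree than \<open>b\<close>, so they lie
  outside the ball, and splitting \<open>r\<close> into linear factors shows that \<open>\<omega>\<^sub>\<delta>(r)\<close> is the value of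
  \<open>r(b) = f(b)\<close>. As the value of \<open>f(b)\<close> is an upper bound of \<open>\<omega>\<^sub>\<delta>(f)\<close>, the remainder cannot cancel
  against \<open>q \<phi>\<close>, that is, \<open>\<omega>\<^sub>\<delta>(f)\<close> is the minimum of \<open>\<omega>\<^sub>\<delta>(q \<phi>)\<close> and \<open>\<omega>\<^sub>\<delta>(r)\<close>
  (\<open>res_division\<close>). Two things follow: \<open>\<phi>\<close> is a key polynomial (\<open>key_polynomial_minpoly\<close>), and
  values are minima over \<open>\<phi>\<close>-expansions (\<open>res_expansion\<close>). The argument uses of \<open>\<delta>\<close> only that
  elements of smaller degree than \<open>b\<close> are not closer to \<open>b\<close> than \<open>\<delta>\<close>. It therefore also works at
  certain smaller radii, and the set \<open>R\<^sub>K\<close> belonging to \<open>\<delta>\<close> provides them: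

  \<^item> If \<open>R\<^sub>K\<close> has a greatest element \<open>\<rho>\<close>, no element of smaller degree than \<open>b\<close> is closer to \<open>a\<close> than
    \<open>\<rho>\<close>, so \<open>\<omega>\<^sub>\<delta>\<close> is an augmentation of \<open>\<omega>\<^sub>\<rho>\<close> (\<open>augmented_res\<close>).
  \<^item> If \<open>R\<^sub>K\<close> has no greatest element, the balls of a cofinal family leave behind every element of
    smaller degree than \<open>b\<close>. So polynomials of smaller degree have eventually constant values, and
    \<open>\<omega>\<^sub>\<delta>\<close> is a limit augmentation (\<open>limit_augmented_res\<close>) of a family which is continuous for the
    same reasons (\<open>continuous_res\<close>).

  The whole family is obtained by induction on \<open>D(m)\<close>, where \<open>m\<close> is the top radius
  (\<open>family_exists\<close>): one descending step leads to a radius with a smaller value of \<open>D\<close>, the induction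
  hypothesis gives a family below it, and the step is undone by appending valuations at the top
  (\<open>tower_augment\<close>, \<open>tower_limit\<close>). The descending construction reads the family in the opposite
  direction, so its first step is put in front of the descent of the lower part (\<open>descent_glue\<close>).
\<close>

section \<open>Arithmetic of values\<close>

lemma extended_add_strict_mono:
  fixes x y x' y' :: "'g::linordered_ab_group_add extended"
  assumes "x < x'" "y \<le> y'" "x \<noteq> -\<infinity>" "y \<noteq> -\<infinity>" "y \<noteq> \<infinity>"
  shows "x + y < x' + y'"
  using assms
  by (cases x; cases y; cases x'; cases y') (auto simp: add_less_le_mono)

lemma extended_diff_le_iff:
  fixes x y :: "'g::linordered_ab_group_add extended"
  shows "x - Fin n \<le> y \<longleftrightarrow> x \<le> y + Fin n"
  by (cases x; cases y) (simp_all add: diff_le_eq)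

lemma nat_times_add: "nat_times (i + j) \<delta> = nat_times i \<delta> + nat_times j \<delta>"
  unfolding nat_times_def by (induction i) (auto simp: ac_simps)

lemma nat_times_Suc: "nat_times (Suc j) \<delta> = \<delta> + nat_times j \<delta>"
  by (simp add: nat_times_def add.commute)

lemma nat_times_0 [simp]: "nat_times 0 \<delta> = 0" 
  by (simp add: nat_times_def)

lemma nat_times_mono:
  fixes \<delta> \<delta>' :: "'g::linordered_ab_group_add"
  shows "\<delta> \<le> \<delta>' \<Longrightarrow> nat_times j \<delta> \<le> nat_times j \<delta>'"
  unfolding nat_times_def by (rule sum_mono)

section \<open>Valuations of an integral domain\<close>

context
  fixes v :: "'r::idom \<Rightarrow> 'g::linordered_ab_group_add extended"
  assumes v: "valuation v"
begin

lemma val_not_Minf [simp]: "v x \<noteq> -\<infinity>"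
  using v by (auto simp: valuation_def)

lemma val_Pinf_iff [simp]: "v x = \<infinity> \<longleftrightarrow> x = 0"
  using v by (auto simp: valuation_def)

lemma val_0 [simp]: "v 0 = \<infinity>"
  by simp

lemma val_mult: "v (x * y) = v x + v y"
  using v by (auto simp: valuation_def)

lemma val_add: "min (v x) (v y) \<le> v (x + y)"
  using v by (auto simp: valuation_def)

lemma val_Fin: "x \<noteq> 0 \<Longrightarrow> \<exists>g. v x = Fin g"
  using val_not_Minf[of x] val_Pinf_iff[of x] by (cases "v x") auto

lemma val_1 [simp]: "v 1 = 0"
proof -
  obtain g where g: "v 1 = Fin g" using val_Fin[of 1] by auto
  show ?thesis using val_mult[of 1 1] g by (simp add: zero_extended_def)
qed

lemma val_minus [simp]: "v (- x) = v x"
proof -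
  obtain g where g: "v (-1) = Fin g" using val_Fin[of "-1"] by auto
  have "v (-1) + v (-1) = 0" using val_mult[of "-1" "-1"] by simp
  hence "v (-1) = 0" using g by (simp add: zero_extended_def)
  thus ?thesis using val_mult[of "-1" x] by simp
qed

lemma val_minus_commute: "v (x - y) = v (y - x)"
  using val_minus[of "x - y"] by simp

lemma val_diff: "min (v x) (v y) \<le> v (x - y)"
  using val_add[of x "- y"] by simp

lemma val_add_eq: 
  assumes "v x < v y" shows "v (x + y) = v x"
proof (rule antisym)
  have "min (v (x + y)) (v y) \<le> v x" using val_diff[of "x + y" y] by simp
  thus "v (x + y) \<le> v x" using assms by (auto simp: min_def split: if_splits)
  show "v x \<le> v (x + y)" using val_add[of x y] assms by (auto simp: min_def split: if_splits)
qed

lemma val_sum_ge: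
  assumes "\<And>k. k \<in> A \<Longrightarrow> T \<le> v (h k)" 
  shows "T \<le> v (sum h A)"
proof (cases "finite A")
  case True
  thus ?thesis using assms
  proof (induction A rule: finite_induct)
    case (insert x F)
    hence "T \<le> min (v (h x)) (v (sum h F))" by auto
    also have "\<dots> \<le> v (h x + sum h F)" by (rule val_add)
    finally show ?case using insert by simp
  qed auto
qed auto

lemma val_sum_greater:
  assumes "\<And>k. k \<in> A \<Longrightarrow> T < v (h k)" "T < \<infinity>"
  shows "T < v (sum h A)"
proof (cases "finite A")
  case True
  thus ?thesis using assms(1)
  proof (induction A rule: finite_induct)
    case empty thus ?case using assms(2) by simp
  next
    case (insert x F)
    hence "T < min (v (h x)) (v (sum h F))" by auto
    also have "\<dots> \<le> v (h x + sum h F)" by (rule val_add)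
    finally show ?case using insert by simp
  qed
next
  case False thus ?thesis using assms(2) by simp
qed

end

section \<open>The Gauss valuation\<close>

definition gauss ::
  "('f::field \<Rightarrow> 'g::linordered_ab_group_add extended) \<Rightarrow> 'g \<Rightarrow> 'f poly \<Rightarrow> 'g extended" where
  "gauss v \<delta> f = (MIN j\<in>{..degree f}. v (coeff f j) + Fin (nat_times j \<delta>))"

context
  fixes v :: "'f::field \<Rightarrow> 'g::linordered_ab_group_add extended"
  assumes v: "valuation v"
begin

lemma le_gauss_iff: "x \<le> gauss v \<delta> f \<longleftrightarrow> (\<forall>j. x \<le> v (coeff f j) + Fin (nat_times j \<delta>))"
proof -
  have "x \<le> gauss v \<delta> f \<longleftrightarrow> (\<forall>j\<le>degree f. x \<le> v (coeff f j) + Fin (nat_times j \<delta>))"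
    by (auto simp: gauss_def)
  moreover have "x \<le> v (coeff f j) + Fin (nat_times j \<delta>)" if "j > degree f" for j
    using that v by (simp add: coeff_eq_0)
  ultimately show ?thesis by (meson not_le)
qed

lemma gauss_le: "gauss v \<delta> f \<le> v (coeff f j) + Fin (nat_times j \<delta>)"
  using le_gauss_iff by blast

lemma gauss_attained: "\<exists>j. gauss v \<delta> f = v (coeff f j) + Fin (nat_times j \<delta>)"
proof -
  have "gauss v \<delta> f \<in> (\<lambda>j. v (coeff f j) + Fin (nat_times j \<delta>)) ` {..degree f}"
    unfolding gauss_def by (rule Min_in) auto
  thus ?thesis by blast
qed

lemma gauss_not_Minf: "gauss v \<delta> f \<noteq> -\<infinity>"
proof -
  obtain j where j: "gauss v \<delta> f = v (coeff f j) + Fin (nat_times j \<delta>)"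
    using gauss_attained by blast
  show ?thesis unfolding j using v by (cases "v (coeff f j)") (auto dest: val_not_Minf[THEN notE])
qed

lemma gauss_Pinf_iff: "gauss v \<delta> f = \<infinity> \<longleftrightarrow> f = 0"
proof
  assume *: "gauss v \<delta> f = \<infinity>"
  have "v (lead_coeff f) = \<infinity>"
    using gauss_le[of \<delta> f "degree f"] val_not_Minf[OF v, of "lead_coeff f"] 
    by (cases "v (lead_coeff f)") (simp_all add: *)
  thus "f = 0" using v by simp
next
  assume "f = 0"
  hence "\<infinity> \<le> gauss v \<delta> f" using v by (simp add: le_gauss_iff)
  thus "gauss v \<delta> f = \<infinity>" by simp
qed

lemma gauss_add: "min (gauss v \<delta> f) (gauss v \<delta> g) \<le> gauss v \<delta> (f + g)"
  unfolding le_gauss_iff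
proof
  fix j
  have "min (gauss v \<delta> f) (gauss v \<delta> g) \<le> 
    min (v (coeff f j) + Fin (nat_times j \<delta>)) (v (coeff g j) + Fin (nat_times j \<delta>))"
    using gauss_le by (metis min.mono)
  also have "\<dots> \<le> min (v (coeff f j)) (v (coeff g j)) + Fin (nat_times j \<delta>)"
    by (auto simp: min_def)
  also have "\<dots> \<le> v (coeff (f + g) j) + Fin (nat_times j \<delta>)"
    using val_add[OF v] by (auto intro: add_right_mono)
  finally show "min (gauss v \<delta> f) (gauss v \<delta> g) \<le> v (coeff (f + g) j) + Fin (nat_times j \<delta>)" .
qed

lemma gauss_first_index:
  obtains i where "gauss v \<delta> f = v (coeff f i) + Fin (nat_times i \<delta>)"
    "\<And>k. k < i \<Longrightarrow> gauss v \<delta> f < v (coeff f k) + Fin (nat_times k \<delta>)"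
proof -
  define P where "P j \<longleftrightarrow> gauss v \<delta> f = v (coeff f j) + Fin (nat_times j \<delta>)" for j
  have "P (Least P)" using gauss_attained[of \<delta> f] unfolding P_def[symmetric] by (metis LeastI)
  moreover have "gauss v \<delta> f < v (coeff f k) + Fin (nat_times k \<delta>)" if "k < Least P" for k
    using not_less_Least[OF that] gauss_le[of \<delta> f k] unfolding P_def by auto
  ultimately show ?thesis using that unfolding P_def by blast
qed

text \<open>
  Gauss's lemma: if the minima for \<open>f\<close> and \<open>g\<close> are first attained at \<open>i\<close> and \<open>j\<close>, then in the
  coefficient of index \<open>i + j\<close> of the product the term \<open>f\<^sub>i g\<^sub>j\<close> strictly dominates.
\<close>
lemma gauss_mult: "gauss v \<delta> (f * g) = gauss v \<delta> f + gauss v \<delta> g"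
proof (cases "f = 0 \<or> g = 0")
  case True
  thus ?thesis using gauss_not_Minf[of \<delta> f] gauss_not_Minf[of \<delta> g] gauss_Pinf_iff[of \<delta> 0]
    by (cases "gauss v \<delta> f"; cases "gauss v \<delta> g") auto
next
  case False
  have fin: "gauss v \<delta> f \<noteq> \<infinity>" "gauss v \<delta> g \<noteq> \<infinity>" using False gauss_Pinf_iff by auto
  define F where "F k = v (coeff f k) + Fin (nat_times k \<delta>)" for k
  define G where "G k = v (coeff g k) + Fin (nat_times k \<delta>)" for k
  have FG: "v (coeff f k * coeff g l) + Fin (nat_times (k + l) \<delta>) = F k + G l" for k l
  proof -
    have "v (coeff f k * coeff g l) + Fin (nat_times (k + l) \<delta>) =
      v (coeff f k) + v (coeff g l) + (Fin (nat_times k \<delta>) + Fin (nat_times l \<delta>))"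
      by (simp add: val_mult[OF v] nat_times_add)
    also have "\<dots> = F k + G l" unfolding F_def G_def by (simp only: ac_simps)
    finally show ?thesis .
  qed
  have Fle: "gauss v \<delta> f \<le> F k" and Gle: "gauss v \<delta> g \<le> G k" for k
    unfolding F_def G_def by (rule gauss_le)+
  obtain i where i: "gauss v \<delta> f = F i" "\<And>k. k < i \<Longrightarrow> gauss v \<delta> f < F k"
    using gauss_first_index[of \<delta> f] unfolding F_def by blast
  obtain j where j: "gauss v \<delta> g = G j" "\<And>k. k < j \<Longrightarrow> gauss v \<delta> g < G k"
    using gauss_first_index[of \<delta> g] unfolding G_def by blast
  show ?thesis
  proof (rule antisym)
    show "gauss v \<delta> f + gauss v \<delta> g \<le> gauss v \<delta> (f * g)"
      unfolding le_gauss_iff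
    proof
      fix n
      have "gauss v \<delta> f + gauss v \<delta> g - Fin (nat_times n \<delta>) \<le> v (coeff f k * coeff g (n - k))" 
        if "k \<in> {..n}" for k
      proof -
        have "gauss v \<delta> f + gauss v \<delta> g \<le> F k + G (n - k)" by (rule add_mono[OF Fle Gle])
        also have "\<dots> = v (coeff f k * coeff g (n - k)) + Fin (nat_times n \<delta>)"
          using that by (simp flip: FG)
        finally show ?thesis by (simp only: extended_diff_le_iff)
      qed
      hence "gauss v \<delta> f + gauss v \<delta> g - Fin (nat_times n \<delta>) \<le> v (coeff (f * g) n)"
        unfolding coeff_mult by (rule val_sum_ge[OF v])
      thus "gauss v \<delta> f + gauss v \<delta> g \<le> v (coeff (f * g) n) + Fin (nat_times n \<delta>)"
        by (simp only: extended_diff_le_iff)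
    qed
    define T where "T = v (coeff f i * coeff g j)"
    have T: "T + Fin (nat_times (i + j) \<delta>) = gauss v \<delta> f + gauss v \<delta> g"
      unfolding T_def FG i(1) j(1) ..
    have Tfin: "T < \<infinity>"
      using T fin gauss_not_Minf[of \<delta> f] gauss_not_Minf[of \<delta> g]
      by (cases T; cases "gauss v \<delta> f"; cases "gauss v \<delta> g") auto
    have big: "T < v (coeff f k * coeff g (i + j - k))" if k: "k \<in> {..i + j} - {i}" for k
    proof -
      have "gauss v \<delta> f + gauss v \<delta> g < F k + G (i + j - k)"
      proof (cases "k < i")
        case True
        show ?thesis
          by (rule extended_add_strict_mono[OF i(2)[OF True] Gle])
             (use fin gauss_not_Minf in auto)
      next
        case False
        hence "i + j - k < j" using k by auto
        from j(2)[OF this] Fle[of k]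
        have "gauss v \<delta> g + gauss v \<delta> f < G (i + j - k) + F k" 
          by (rule extended_add_strict_mono) (use fin gauss_not_Minf in auto)
        thus ?thesis by (simp add: add.commute)
      qed
      also have "\<dots> = v (coeff f k * coeff g (i + j - k)) + Fin (nat_times (i + j) \<delta>)"
        using FG[of k "i + j - k"] k by auto
      finally have "\<not> v (coeff f k * coeff g (i + j - k)) + Fin (nat_times (i + j) \<delta>) 
          \<le> T + Fin (nat_times (i + j) \<delta>)"
        unfolding T by (simp only: not_le)
      hence "\<not> v (coeff f k * coeff g (i + j - k)) \<le> T" using add_right_mono by blast
      thus ?thesis by (simp only: not_le)
    qed
    have "coeff (f * g) (i + j) = coeff f i * coeff g j + 
      (\<Sum>k\<in>{..i + j} - {i}. coeff f k * coeff g (i + j - k))"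
      unfolding coeff_mult by (subst sum.remove[of _ i]) auto
    also have "v \<dots> = T"
      unfolding T_def
      by (rule val_add_eq[OF v], fold T_def, rule val_sum_greater[OF v big Tfin])
    finally have "v (coeff (f * g) (i + j)) = T" .
    thus "gauss v \<delta> (f * g) \<le> gauss v \<delta> f + gauss v \<delta> g"
      using gauss_le[of \<delta> "f * g" "i + j"] T by simp
  qed
qed

lemma valuation_gauss: "valuation (gauss v \<delta>)"
  unfolding valuation_def using gauss_not_Minf gauss_Pinf_iff gauss_mult gauss_add by blast

end

section \<open>The valuation of a ball\<close>

lemma omega_gauss: "omega v a \<delta> f = gauss v \<delta> (pcompose f [:a, 1:])"
  by (simp add: omega_def gauss_def degree_pcompose)

context
  fixes v :: "'f::field \<Rightarrow> 'g::linordered_ab_group_add extended"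
  assumes v: "valuation v"
begin

lemma valuation_omega: "valuation (omega v a \<delta>)"
proof -
  have "pcompose f [:a, 1:] = 0 \<longleftrightarrow> f = 0" for f :: "'f poly"
    by (rule pcompose_eq_0_iff) simp
  thus ?thesis
    using valuation_gauss[OF v, of \<delta>] unfolding valuation_def omega_gauss
    by (simp add: pcompose_mult pcompose_add)
qed

lemma omega_const: "omega v a \<delta> [:c:] = v c"
  by (simp add: omega_def flip: zero_extended_def)

lemma omega_le_poly: "omega v a \<delta> f \<le> v (poly f a)"
proof -
  have "coeff (pcompose f [:a, 1:]) 0 = poly f a" by (simp add: poly_pcompose flip: poly_0_coeff_0)
  thus ?thesis using gauss_le[OF v, of \<delta> "pcompose f [:a, 1:]" 0]
    by (simp add: omega_gauss flip: zero_extended_def)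
qed

lemma omega_linear: "omega v a \<delta> [:- c, 1:] = min (v (a - c)) (Fin \<delta>)"
proof -
  have "{..Suc 0} = {0, 1}" by auto
  thus ?thesis
    using v by (simp add: omega_def pcompose_pCons nat_times_Suc flip: zero_extended_def)
qed

lemma omega_mono: "\<delta> \<le> \<delta>' \<Longrightarrow> omega v a \<delta> f \<le> omega v a \<delta>' f"
  unfolding omega_gauss le_gauss_iff[OF v]
  by (meson add_left_mono gauss_le[OF v] less_eq_extended.simps(1) nat_times_mono order_trans)

end

text \<open>
  Multiplicativity reduces comparisons of valuations of polynomials to linear factors. This is how
  the algebraic closedness of \<open>'l\<close> enters the computation of \<open>omega\<close>.
\<close>
lemma multiplicative_poly_eqI:
  fixes f :: "'l::alg_closed_field poly" and W W' :: "'l poly \<Rightarrow> 'v::plus"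
  assumes "\<And>g h. W (g * h) = W g + W h" "\<And>g h. W' (g * h) = W' g + W' h"
    and "\<And>c. W [:c:] = W' [:c:]" 
    and "f \<noteq> 0" "\<And>c. poly f c = 0 \<Longrightarrow> W [:- c, 1:] = W' [:- c, 1:]"
  shows "W f = W' f"
  using assms(4,5)
proof (induction "degree f" arbitrary: f rule: less_induct)
  case less
  show ?case
  proof (cases "degree f = 0")
    case True
    then obtain c where "f = [:c:]" by (rule degree_eq_zeroE)
    thus ?thesis using assms(3) by simp
  next
    case False
    then obtain c where c: "poly f c = 0" using alg_closed_imp_poly_has_root by blast
    then obtain h where h: "f = [:- c, 1:] * h" by (auto simp: poly_eq_0_iff_dvd dvd_def)
    have "h \<noteq> 0" using less.prems(1) h by auto
    hence "degree f = Suc (degree h)" unfolding h by (subst degree_mult_eq) auto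
    hence "W h = W' h" using less.hyps[of h] less.prems(2) \<open>h \<noteq> 0\<close> unfolding h by auto
    thus ?thesis using less.prems(2)[OF c] unfolding h assms(1,2) by simp
  qed
qed

context
  fixes v :: "'l::alg_closed_field \<Rightarrow> 'g::linordered_ab_group_add extended"
  assumes v: "valuation v"
begin

lemma omega_mult: "omega v a \<delta> (f * g) = omega v a \<delta> f + omega v a \<delta> g"
  by (rule val_mult[OF valuation_omega[OF v]])

text \<open>
  If no root of \<open>f\<close> is strictly inside the ball, each linear factor already attains its value at the
  centre, so the value of \<open>f\<close> is that of its constant term at \<open>a\<close>.
\<close>
lemma omega_eq_poly:
  assumes "f \<noteq> 0" "\<And>c. poly f c = 0 \<Longrightarrow> v (a - c) \<le> Fin \<delta>"
  shows "omega v a \<delta> f = v (poly f a)"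
proof (rule multiplicative_poly_eqI[where W = "omega v a \<delta>" and W' = "\<lambda>f. v (poly f a)"])
  fix c assume "poly f c = 0"
  thus "omega v a \<delta> [:- c, 1:] = v (poly [:- c, 1:] a)"
    using assms(2)[of c] by (simp add: omega_linear[OF v] min_def)
qed (use assms in \<open>auto simp: omega_mult omega_const[OF v] val_mult[OF v]\<close>)

lemma omega_center:
  assumes "Fin \<delta> \<le> v (a - b)" 
  shows "omega v a \<delta> = omega v b \<delta>"
proof
  fix f
  have le: "min (v (a' - c)) (Fin \<delta>) \<le> min (v (b' - c)) (Fin \<delta>)" 
    if "Fin \<delta> \<le> v (b' - a')" for a' b' c
  proof -
    have "min (v (b' - a')) (v (a' - c)) \<le> v (b' - c)"
      using val_add[OF v, of "b' - a'" "a' - c"] by simp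
    thus ?thesis using that by (auto simp: min_def split: if_splits)
  qed
  show "omega v a \<delta> f = omega v b \<delta> f"
  proof (cases "f = 0")
    case False
    show ?thesis
    proof (rule multiplicative_poly_eqI[where W = "omega v a \<delta>" and W' = "omega v b \<delta>"])
      fix c
      show "omega v a \<delta> [:- c, 1:] = omega v b \<delta> [:- c, 1:]"
        unfolding omega_linear[OF v] 
        using le[of b a] le[of a b] assms val_minus_commute[OF v, of a b] by (auto intro: antisym)
    qed (use False in \<open>auto simp: omega_mult omega_const[OF v]\<close>)
  qed (simp add: omega_const[OF v, of _ _ 0, simplified])
qed

text \<open>
  A root in the smaller ball contributes a linear factor whose value is the radius itself; no other
  factor can decrease.
\<close>
lemma omega_strict_mono:
  assumes "f \<noteq> 0" "poly f c = 0" "\<delta> < \<delta>'" "Fin \<delta>' \<le> v (a - c)"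
  shows "omega v a \<delta> f < omega v a \<delta>' f"
proof -
  obtain h where h: "f = [:- c, 1:] * h" using assms(2) by (auto simp: poly_eq_0_iff_dvd dvd_def)
  have "h \<noteq> 0" using assms(1) h by auto
  have "omega v a \<delta> [:- c, 1:] = Fin \<delta>" "omega v a \<delta>' [:- c, 1:] = Fin \<delta>'"
    using assms(3,4) order_trans[of "Fin \<delta>" "Fin \<delta>'" "v (a - c)"]
    by (auto simp: omega_linear[OF v] intro: min_absorb2)
  moreover have "Fin \<delta> + omega v a \<delta> h < Fin \<delta>' + omega v a \<delta>' h"
    by (rule extended_add_strict_mono)
      (use assms(3) \<open>h \<noteq> 0\<close> valuation_omega[OF v] omega_mono[OF v] in auto)
  ultimately show ?thesis unfolding h omega_mult by simp
qed

end

section \<open>Algebraic degree\<close>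

context
  fixes emb :: "'k::field \<Rightarrow> 'l::alg_closed_field"
  assumes emb: "algebraic_closure_embedding emb"
begin

lemma emb_1 [simp]: "emb 1 = 1"
  and emb_add [simp]: "emb (x + y) = emb x + emb y"
  and emb_mult [simp]: "emb (x * y) = emb x * emb y"
  using emb by (auto simp: algebraic_closure_embedding_def)

lemma emb_0 [simp]: "emb 0 = 0"
  using emb_add[of 0 0] by (metis add_cancel_right_right)

lemma emb_minus [simp]: "emb (- x) = - emb x"
  using emb_add[of x "- x"] by (simp del: emb_add add: eq_neg_iff_add_eq_0 add.commute)

lemma emb_eq_0_iff [simp]: "emb x = 0 \<longleftrightarrow> x = 0"
proof
  assume *: "emb x = 0"
  show "x = 0"
  proof (rule ccontr)
    assume "x \<noteq> 0"
    hence "emb x * emb (inverse x) = 1" by (simp flip: emb_mult)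
    thus False using * by simp
  qed
qed simp

lemma emb_sum: "emb (sum h A) = (\<Sum>x\<in>A. emb (h x))"
  by (induction A rule: infinite_finite_induct) auto

lemma coeff_map_emb [simp]: "coeff (map_poly emb f) n = emb (coeff f n)"
  by (simp add: coeff_map_poly)

lemma map_emb_add [simp]: "map_poly emb (f + g) = map_poly emb f + map_poly emb g"
  by (rule poly_eqI) simp

lemma map_emb_minus [simp]: "map_poly emb (- f) = - map_poly emb f"
  by (rule poly_eqI) simp

lemma map_emb_diff [simp]: "map_poly emb (f - g) = map_poly emb f - map_poly emb g"
  using map_emb_add[of f "- g"] by simp

lemma map_emb_mult [simp]: "map_poly emb (f * g) = map_poly emb f * map_poly emb g"
  by (rule poly_eqI) (simp add: coeff_mult emb_sum)

lemma map_emb_eq_0_iff [simp]: "map_poly emb f = 0 \<longleftrightarrow> f = 0"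
  by (auto simp: poly_eq_iff)

lemma degree_map_emb [simp]: "degree (map_poly emb f) = degree f"
  by (rule degree_map_poly) simp

lemma map_emb_pCons [simp]: "map_poly emb (pCons c f) = pCons (emb c) (map_poly emb f)"
  by (simp add: map_poly_pCons)

lemma poly_map_emb: 
  assumes "degree f < n" shows "poly (map_poly emb f) b = (\<Sum>i<n. emb (coeff f i) * b ^ i)"
proof -
  have "poly (map_poly emb f) b = (\<Sum>i\<le>degree f. emb (coeff f i) * b ^ i)"
    by (simp add: poly_altdef)
  also have "\<dots> = (\<Sum>i<n. emb (coeff f i) * b ^ i)"
    by (rule sum.mono_neutral_left) (use assms in \<open>auto simp: coeff_eq_0\<close>)
  finally show ?thesis .
qed

lemma least_annihilator:
  obtains p where "p \<noteq> 0" "poly (map_poly emb p) b = 0"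
    "\<And>q. q \<noteq> 0 \<Longrightarrow> poly (map_poly emb q) b = 0 \<Longrightarrow> degree p \<le> degree q"
proof -
  obtain p where "p \<noteq> 0 \<and> poly (map_poly emb p) b = 0"
    using emb unfolding algebraic_closure_embedding_def by blast
  from ex_has_least_nat[of "\<lambda>p. p \<noteq> 0 \<and> poly (map_poly emb p) b = 0", OF this, of degree] that
  show ?thesis by blast
qed

text \<open>
  The values at \<open>b\<close> of the polynomials over \<open>K\<close> form a field: a nonzero value \<open>x\<close> is a root of some
  \<open>c + X q(X)\<close> with \<open>c \<noteq> 0\<close> by minimality of the degree, so its inverse is \<open>- q(x) / c\<close>.
\<close>
lemma adjoin_subset_polys: "adjoin emb b \<subseteq> range (\<lambda>g. poly (map_poly emb g) b)"
proof -
  define A where "A = range (\<lambda>g. poly (map_poly emb g) b)"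
  have const: "emb c \<in> A" for c
    unfolding A_def by (rule range_eqI[of _ _ "[:c:]"]) simp
  have add: "x + y \<in> A" if xy: "x \<in> A" "y \<in> A" for x y
  proof -
    from xy obtain g h where "x = poly (map_poly emb g) b" "y = poly (map_poly emb h) b"
      by (auto simp: A_def)
    thus ?thesis unfolding A_def by (intro range_eqI[of _ _ "g + h"]) simp
  qed
  have mult: "x * y \<in> A" if xy: "x \<in> A" "y \<in> A" for x y
  proof -
    from xy obtain g h where "x = poly (map_poly emb g) b" "y = poly (map_poly emb h) b"
      by (auto simp: A_def)
    thus ?thesis unfolding A_def by (intro range_eqI[of _ _ "g * h"]) simp
  qed
  have minus: "- x \<in> A" if x: "x \<in> A" for x
    using mult[OF const[of "-1"] x] by simp
  have inv: "inverse x \<in> A" if x: "x \<in> A" for x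
  proof (cases "x = 0")
    case True thus ?thesis using x by simp
  next
    case False
    have closed: "poly (map_poly emb q) x \<in> A" for q
      by (induction q) (auto intro: add mult const x simp: const[of 0, simplified])
    obtain p where p: "p \<noteq> 0" "poly (map_poly emb p) x = 0"
      and min: "\<And>q. q \<noteq> 0 \<Longrightarrow> poly (map_poly emb q) x = 0 \<Longrightarrow> degree p \<le> degree q"
      using least_annihilator by blast
    obtain c q where pq: "p = pCons c q" by (cases p)
    have eq: "emb c + x * poly (map_poly emb q) x = 0" using p(2) by (simp add: pq)
    have "c \<noteq> 0"
    proof
      assume "c = 0"
      hence "q \<noteq> 0" "poly (map_poly emb q) x = 0" using p(1) eq False by (auto simp: pq)
      with min[OF this] show False by (simp add: pq)
    qed
    hence "x * (poly (map_poly emb q) x * emb (- inverse c)) = emb c * emb (inverse c)"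
      using eq by (simp add: add_eq_0_iff2 mult.assoc)
    also have "\<dots> = 1" using \<open>c \<noteq> 0\<close> by (simp flip: emb_mult)
    finally have inv_eq: "inverse x = poly (map_poly emb q) x * emb (- inverse c)"
      by (rule inverse_unique)
    show ?thesis unfolding inv_eq by (rule mult[OF closed const])
  qed
  have "b \<in> A" unfolding A_def by (rule range_eqI[of _ _ "[:0, 1:]"]) simp
  hence "is_subfield A \<and> range emb \<subseteq> A \<and> b \<in> A"
    using const[of 0] const[of 1] const add mult minus inv by (auto simp: is_subfield_def)
  thus ?thesis unfolding A_def[symmetric] adjoin_def by blast
qed

text \<open>
  Identifies the dimension in \<open>degK\<close> with the degree of the minimal polynomial: the powers of \<open>b\<close>
  below that degree are independent by minimality and span by division with remainder.
\<close>
lemma minimal_polynomial: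
  obtains \<phi> where "lead_coeff \<phi> = 1" "poly (map_poly emb \<phi>) b = 0" "degree \<phi> = degK emb b"
    "\<And>f. f \<noteq> 0 \<Longrightarrow> poly (map_poly emb f) b = 0 \<Longrightarrow> degK emb b \<le> degree f"
proof -
  interpret V: vector_space "\<lambda>c (y::'l). emb c * y"
    by unfold_locales (auto simp: algebra_simps)
  obtain p where p: "p \<noteq> 0" "poly (map_poly emb p) b = 0"
    and min: "\<And>q. q \<noteq> 0 \<Longrightarrow> poly (map_poly emb q) b = 0 \<Longrightarrow> degree p \<le> degree q"
    using least_annihilator by blast
  define \<phi> where "\<phi> = [:inverse (lead_coeff p):] * p"
  have \<phi>: "lead_coeff \<phi> = 1" "poly (map_poly emb \<phi>) b = 0" "degree \<phi> = degree p"
  proof -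
    show "lead_coeff \<phi> = 1" using p unfolding \<phi>_def by (simp only: lead_coeff_mult) simp
    show "poly (map_poly emb \<phi>) b = 0" using p unfolding \<phi>_def by (simp only: map_emb_mult poly_mult) simp
    show "degree \<phi> = degree p" using p unfolding \<phi>_def by (subst degree_mult_eq) auto
  qed
  define n where "n = degree \<phi>"
  have small: "q = 0" if "degree q < n" "poly (map_poly emb q) b = 0" for q
    using min[of q] that \<phi>(3) unfolding n_def by linarith
  define B where "B = (\<lambda>i. b ^ i) ` {..<n}"
  have ne: "b ^ i \<noteq> b ^ j" if "i < j" "j < n" for i j
  proof
    assume eq: "b ^ i = b ^ j"
    define q :: "'k poly" where "q = monom 1 j - monom 1 i"
    have q: "degree q < n" unfolding q_def
      by (rule le_less_trans[OF degree_diff_le_max]) (use that in \<open>simp add: degree_monom_eq\<close>)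
    have "poly (map_poly emb q) b = 0"
      by (simp add: q_def map_poly_monom poly_monom eq)
    hence "q = 0" using small[OF q] by simp
    moreover have "coeff q j = 1" using that by (simp add: q_def)
    ultimately show False by simp
  qed
  have inj: "inj_on (\<lambda>i. b ^ i) {..<n}"
    by (rule linorder_inj_onI') (use ne in auto)
  have "V.dim (adjoin emb b) = n"
  proof (rule V.dim_unique)
    show "B \<subseteq> adjoin emb b"
    proof -
      have "b ^ i \<in> F" if "is_subfield F" "b \<in> F" for F i
        using that by (induction i) (auto simp: is_subfield_def)
      thus ?thesis unfolding B_def adjoin_def by blast
    qed
    show "card B = n" unfolding B_def by (simp add: card_image inj)
    show "V.independent B"
    proof (rule V.independent_if_scalars_zero)
      fix u y assume *: "(\<Sum>x\<in>B. emb (u x) * x) = 0" and y: "y \<in> B"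
      define q where "q = (\<Sum>i<n. monom (u (b ^ i)) i)"
      have coeff: "coeff q i = (if i < n then u (b ^ i) else 0)" for i
        by (simp add: q_def coeff_sum)
      from y have "n > 0" by (auto simp: B_def)
      hence deg: "degree q < n"
        using coeff by (metis degree_0 leading_coeff_0_iff)
      have "poly (map_poly emb q) b = (\<Sum>i<n. emb (u (b ^ i)) * b ^ i)"
        by (simp add: poly_map_emb[OF deg] coeff)
      also have "\<dots> = 0" using * unfolding B_def by (simp add: sum.reindex inj)
      finally have "q = 0" by (rule small[OF deg])
      obtain i where "i < n" "y = b ^ i" using y by (auto simp: B_def)
      thus "u y = 0" using coeff[of i] \<open>q = 0\<close> by simp
    qed (auto simp: B_def)
    show "adjoin emb b \<subseteq> V.span B"
    proof
      fix x assume "x \<in> adjoin emb b"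
      then obtain g where g: "x = poly (map_poly emb g) b" using adjoin_subset_polys by blast
      have "n > 0"
      proof (rule ccontr)
        assume "\<not> n > 0"
        hence "\<phi> = [:1:]" using \<phi>(1) by (metis degree_eq_zeroE lead_coeff_pCons(2) n_def not_gr0)
        thus False using \<phi>(2) by simp
      qed
      hence deg: "degree (g mod \<phi>) < n" 
        using degree_mod_less'[of \<phi> g] unfolding n_def 
        by (cases "\<phi> = 0"; cases "g mod \<phi> = 0") auto
      have "g = \<phi> * (g div \<phi>) + g mod \<phi>" by simp
      hence "map_poly emb g = map_poly emb \<phi> * map_poly emb (g div \<phi>) + map_poly emb (g mod \<phi>)"
        by (metis map_emb_add map_emb_mult)
      hence "x = (\<Sum>i<n. emb (coeff (g mod \<phi>) i) * b ^ i)"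
        using \<phi>(2) by (simp add: g poly_map_emb[OF deg])
      also have "\<dots> \<in> V.span B"
        by (intro V.span_sum V.span_scale V.span_base) (auto simp: B_def)
      finally show "x \<in> V.span B" .
    qed
  qed
  hence "degree \<phi> = degK emb b" by (simp add: degK_def n_def)
  thus ?thesis using that[of \<phi>] \<phi> min by simp
qed

lemma degK_le: "f \<noteq> 0 \<Longrightarrow> poly (map_poly emb f) b = 0 \<Longrightarrow> degK emb b \<le> degree f"
  using minimal_polynomial by metis

lemma degK_pos: "degK emb b > 0"
proof -
  obtain \<phi> where "lead_coeff \<phi> = 1" "poly (map_poly emb \<phi>) b = 0" "degree \<phi> = degK emb b"
    using minimal_polynomial by metis
  thus ?thesis 
    by (metis degree_eq_zeroE gr0I lead_coeff_pCons(2) map_emb_pCons emb_1 map_poly_0 poly_pCons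
        mult_zero_right poly_0 add_0_right zero_neq_one)
qed

lemma degK_emb: "degK emb (emb c) = 1"
proof -
  have "degK emb (emb c) \<le> degree [:- c, 1:]" by (rule degK_le) auto
  thus ?thesis using degK_pos[of "emb c"] by simp
qed

lemma degK_1_imp: "degK emb b = 1 \<Longrightarrow> b \<in> range emb"
proof -
  assume d: "degK emb b = 1"
  obtain \<phi> where \<phi>: "lead_coeff \<phi> = 1" "poly (map_poly emb \<phi>) b = 0" "degree \<phi> = 1"
    using minimal_polynomial d by metis
  obtain c0 c1 where "\<phi> = [:c0, c1:]" using \<phi>(3) degree1_coeffs by blast
  hence "b = emb (- c0)" using \<phi> by (auto simp: add_eq_0_iff)
  thus ?thesis by blast
qed

end

section \<open>Key polynomials\<close>

lemma Min_Suc_shift: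
  fixes F :: "nat \<Rightarrow> 'a::linorder"
  shows "(MIN j\<in>{..Suc n}. F j) = min (F 0) (MIN j\<in>{..n}. F (Suc j))"
  by (simp add: atMost_Suc_eq_insert_0 image_image)

lemma Min_add_const:
  fixes F :: "nat \<Rightarrow> 'g::linordered_ab_group_add extended"
  shows "(MIN j\<in>{..n}. F j + c) = (MIN j\<in>{..n}. F j) + c"
proof -
  have "mono (\<lambda>x::'g extended. x + c)" by (rule monoI) (rule add_right_mono)
  from mono_Min_commute[OF this, of "F ` {..n}"] show ?thesis by (simp add: image_image)
qed

context
  fixes emb :: "'k::field \<Rightarrow> 'l::alg_closed_field"
    and v :: "'l \<Rightarrow> 'g::linordered_ab_group_add extended"
begin

abbreviation res :: "'l \<Rightarrow> 'g \<Rightarrow> 'k poly \<Rightarrow> 'g extended" where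
  "res a \<delta> \<equiv> restrict_poly emb (omega v a \<delta>)"

abbreviation evalK :: "'k poly \<Rightarrow> 'l \<Rightarrow> 'l" where
  "evalK f b \<equiv> poly (map_poly emb f) b"

definition minpoly :: "'l \<Rightarrow> 'k poly \<Rightarrow> bool" where
  "minpoly b \<phi> \<longleftrightarrow> lead_coeff \<phi> = 1 \<and> evalK \<phi> b = 0 \<and> degree \<phi> = degK emb b"

text \<open>
  The elements of degree below \<open>d\<close> do not come closer to \<open>a\<close> than \<open>\<delta>\<close>. The inequality is weak on
  purpose: if \<open>\<delta>\<close> is the greatest radius in \<open>R\<^sub>K\<close>, elements of lower degree at distance exactly
  \<open>\<delta>\<close> do exist, and the augmentation from \<open>\<delta>\<close> to the next radius needs this borderline case.
\<close>
definition apart :: "'l \<Rightarrow> 'g \<Rightarrow> nat \<Rightarrow> bool" where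
  "apart a \<delta> d \<longleftrightarrow> (\<forall>c. degK emb c < d \<longrightarrow> v (a - c) \<le> Fin \<delta>)"

context
  assumes emb: "algebraic_closure_embedding emb" and v: "valuation v"
begin

lemma minpoly_exists: "\<exists>\<phi>. minpoly b \<phi>"
  using minimal_polynomial[OF emb, of b] unfolding minpoly_def by metis

lemma minpoly_nz: "minpoly b \<phi> \<Longrightarrow> \<phi> \<noteq> 0"
  by (auto simp: minpoly_def)

lemma minpoly_degree_pos: "minpoly b \<phi> \<Longrightarrow> degree \<phi> > 0"
  using degK_pos[OF emb, of b] by (simp add: minpoly_def)

lemma degree_minpoly: "minpoly b \<phi> \<Longrightarrow> degree \<phi> = degK emb b"
  by (simp add: minpoly_def)

lemma degree_mod_minpoly: "minpoly b \<phi> \<Longrightarrow> degree (f mod \<phi>) < degK emb b"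
  using degree_mod_less'[of \<phi> f] minpoly_degree_pos[of b \<phi>] minpoly_nz[of b \<phi>]
  by (cases "f mod \<phi> = 0") (simp_all add: degree_minpoly)

lemma eval_mod_minpoly: 
  assumes "minpoly b \<phi>" shows "evalK (f mod \<phi>) b = evalK f b"
proof -
  have "map_poly emb f = map_poly emb (f div \<phi>) * map_poly emb \<phi> + map_poly emb (f mod \<phi>)"
    by (metis div_mult_mod_eq map_emb_add[OF emb] map_emb_mult[OF emb])
  thus ?thesis using assms by (simp add: minpoly_def)
qed

lemma valuation_res: "valuation (res a \<delta>)"
  using valuation_omega[OF v, of a \<delta>] unfolding valuation_def restrict_poly_def
  by (simp add: map_emb_add[OF emb] map_emb_mult[OF emb] map_emb_eq_0_iff[OF emb])

lemma res_mono: "\<delta> \<le> \<delta>' \<Longrightarrow> res a \<delta> f \<le> res a \<delta>' f"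
  by (simp add: restrict_poly_def omega_mono[OF v])

lemma res_le_eval: "res a \<delta> f \<le> v (evalK f a)"
  by (simp add: restrict_poly_def omega_le_poly[OF v])

lemma res_eq_eval:
  assumes "\<And>c. f \<noteq> 0 \<Longrightarrow> evalK f c = 0 \<Longrightarrow> v (a - c) \<le> Fin \<delta>"
  shows "res a \<delta> f = v (evalK f a)"
proof (cases "f = 0")
  case True
  thus ?thesis using valuation_res[of a \<delta>] v by simp
next
  case False
  thus ?thesis using omega_eq_poly[OF v, of "map_poly emb f" a \<delta>] assms
    by (simp add: restrict_poly_def map_emb_eq_0_iff[OF emb])
qed

lemma res_strict_mono:
  assumes "f \<noteq> 0" "evalK f c = 0" "\<delta> < \<delta>'" "Fin \<delta>' \<le> v (a - c)"
  shows "res a \<delta> f < res a \<delta>' f"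
  using omega_strict_mono[OF v, of "map_poly emb f" c \<delta> \<delta>' a] assms
  by (simp add: restrict_poly_def map_emb_eq_0_iff[OF emb])

lemma res_center: "Fin \<delta> \<le> v (a - b) \<Longrightarrow> res a \<delta> = res b \<delta>"
  by (simp add: omega_center[OF v])

lemma apart_mono: "apart a \<delta> d \<Longrightarrow> \<delta> \<le> \<delta>' \<Longrightarrow> apart a \<delta>' d"
  unfolding apart_def by (meson less_eq_extended.simps(1) order_trans)

lemma apart_center:
  assumes "apart a \<delta> d" "Fin \<delta> < v (a - b)"
  shows "apart b \<delta> d"
  unfolding apart_def
proof (intro allI impI)
  fix c assume "degK emb c < d"
  hence "v (a - c) \<le> Fin \<delta>" using assms(1) by (simp add: apart_def)
  moreover have "min (v (a - b)) (v (b - c)) \<le> v (a - c)"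
    using val_add[OF v, of "a - b" "b - c"] by simp
  ultimately show "v (b - c) \<le> Fin \<delta>"
    using assms(2) by (auto simp: min_def split: if_splits)
qed

lemma res_low_degree:
  assumes "apart a \<delta> d" "degree f < d"
  shows "res a \<delta> f = v (evalK f a)"
proof (rule res_eq_eval)
  fix c assume "f \<noteq> 0" "evalK f c = 0"
  hence "degK emb c \<le> degree f" by (rule degK_le[OF emb])
  thus "v (a - c) \<le> Fin \<delta>" using assms by (simp add: apart_def)
qed

text \<open>
  The heart of the matter: \<open>q \<phi>\<close> and \<open>r\<close> cannot cancel. Indeed \<open>f = q \<phi> + r\<close> and \<open>r\<close> have the same
  value at \<open>b\<close>, the value of \<open>f\<close> is at most that of \<open>f(b)\<close>, and for \<open>r\<close> equality holds because its
  roots are too far away; hence the value of \<open>f\<close> is at most that of \<open>r\<close>.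
\<close>
lemma res_division:
  assumes "minpoly b \<phi>" "apart b \<delta> (degK emb b)" "degree r < degK emb b"
  shows "res b \<delta> (q * \<phi> + r) = min (res b \<delta> (q * \<phi>)) (res b \<delta> r)"
proof -
  have "evalK (q * \<phi> + r) b = evalK r b"
    using assms(1) by (simp add: minpoly_def map_emb_add[OF emb] map_emb_mult[OF emb])
  hence 1: "res b \<delta> (q * \<phi> + r) \<le> res b \<delta> r"
    using res_le_eval[of b \<delta> "q * \<phi> + r"] res_low_degree[OF assms(2,3)] by simp
  have "min (res b \<delta> (q * \<phi> + r)) (res b \<delta> r) \<le> res b \<delta> (q * \<phi>)"
    using val_diff[OF valuation_res, of b \<delta> "q * \<phi> + r" r] by simp
  with 1 have "res b \<delta> (q * \<phi> + r) \<le> res b \<delta> (q * \<phi>)" by (simp add: min_def)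
  thus ?thesis using 1 val_add[OF valuation_res, of b \<delta> "q * \<phi>" r] by (auto intro: antisym)
qed

lemma res_le_mod:
  assumes "minpoly b \<phi>" "apart b \<delta> (degK emb b)"
  shows "res b \<delta> f \<le> res b \<delta> (f mod \<phi>)"
  using res_division[OF assms degree_mod_minpoly[OF assms(1)], of "f div \<phi>" f] by simp

lemma mu_divides_iff:
  assumes "minpoly b \<phi>" "apart b \<delta> (degK emb b)"
  shows "mu_divides (res b \<delta>) \<phi> f \<longleftrightarrow> res b \<delta> f < res b \<delta> (f mod \<phi>)"
proof
  assume "mu_divides (res b \<delta>) \<phi> f"
  then obtain h where "res b \<delta> f < res b \<delta> (f - \<phi> * h)"
    by (auto simp: mu_divides_def mu_equivalent_def)
  also have "\<dots> \<le> res b \<delta> ((f - \<phi> * h) mod \<phi>)" by (rule res_le_mod[OF assms])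
  also have "(f - \<phi> * h) mod \<phi> = f mod \<phi>" 
    using mod_mult_self2[of f \<phi> "- h"] by simp
  finally show "res b \<delta> f < res b \<delta> (f mod \<phi>)" .
next
  assume less: "res b \<delta> f < res b \<delta> (f mod \<phi>)"
  have eq: "f - f mod \<phi> = \<phi> * (f div \<phi>)" by (simp add: minus_mod_eq_mult_div)
  have "res b \<delta> (f + - (f mod \<phi>)) = res b \<delta> f"
    by (rule val_add_eq[OF valuation_res]) (use less val_minus[OF valuation_res] in simp)
  hence "mu_equivalent (res b \<delta>) f (\<phi> * (f div \<phi>))"
    using less unfolding mu_equivalent_def eq[symmetric] by simp
  thus "mu_divides (res b \<delta>) \<phi> f" unfolding mu_divides_def by blast
qed

text \<open>
  By the divisibility criterion, \<open>\<phi>\<close> fails to divide \<open>f\<close> exactly when the value of \<open>f\<close> is the value of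
  \<open>f(b)\<close>. This condition is multiplicative in \<open>f\<close>, which gives irreducibility.
\<close>
lemma key_polynomial_minpoly:
  assumes "minpoly b \<phi>" "apart b \<delta> (degK emb b)"
  shows "key_polynomial (res b \<delta>) \<phi>"
proof -
  note div = mu_divides_iff[OF assms]
  have "\<not> mu_divides (res b \<delta>) \<phi> 1"
    using minpoly_degree_pos[OF assms(1)] by (simp add: div mod_poly_less)
  moreover have "mu_divides (res b \<delta>) \<phi> f \<or> mu_divides (res b \<delta>) \<phi> g"
    if "mu_divides (res b \<delta>) \<phi> (f * g)" for f g
  proof (rule ccontr)
    have mod: "res b \<delta> (h mod \<phi>) = v (evalK h b)" for h
      using res_low_degree[OF assms(2) degree_mod_minpoly[OF assms(1)]] 
        eval_mod_minpoly[OF assms(1)] by simp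
    assume "\<not> ?thesis"
    hence "res b \<delta> f = v (evalK f b)" "res b \<delta> g = v (evalK g b)"
      using res_le_eval unfolding div mod by (auto intro: antisym)
    hence "res b \<delta> (f * g) = v (evalK (f * g) b)"
      using val_mult[OF valuation_res] val_mult[OF v] by (simp add: map_emb_mult[OF emb])
    thus False using that unfolding div mod by simp
  qed
  moreover have "degree \<phi> \<le> degree f" if "mu_divides (res b \<delta>) \<phi> f" for f
    using that unfolding div by (metis mod_poly_less not_less order_less_irrefl)
  ultimately show ?thesis
    using assms(1) by (auto simp: key_polynomial_def mu_irreducible_def mu_minimal_def minpoly_def)
qed

lemma res_expansion:
  assumes "minpoly b \<phi>" "apart b \<delta> (degK emb b)" "res b \<delta> \<phi> = Fin \<gamma>"
    and "\<forall>j\<le>n. degree (g j) < degK emb b"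
  shows "res b \<delta> (\<Sum>j\<le>n. g j * \<phi> ^ j) = (MIN j\<in>{..n}. res b \<delta> (g j) + Fin (nat_times j \<gamma>))"
  using assms(4)
proof (induction n arbitrary: g)
  case 0
  thus ?case by (simp flip: zero_extended_def)
next
  case (Suc n)
  have "(\<Sum>j\<le>Suc n. g j * \<phi> ^ j) = (\<Sum>j\<le>n. g (Suc j) * \<phi> ^ j) * \<phi> + g 0"
    by (simp only: sum.atMost_Suc_shift) (simp add: sum_distrib_left sum_distrib_right ac_simps)
  also have "res b \<delta> \<dots> = min (res b \<delta> ((\<Sum>j\<le>n. g (Suc j) * \<phi> ^ j) * \<phi>)) (res b \<delta> (g 0))"
    by (rule res_division[OF assms(1,2)]) (use Suc.prems in simp)
  also have "res b \<delta> ((\<Sum>j\<le>n. g (Suc j) * \<phi> ^ j) * \<phi>) = 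
    (MIN j\<in>{..n}. res b \<delta> (g (Suc j)) + Fin (nat_times j \<gamma>)) + Fin \<gamma>"
    using Suc.IH[of "\<lambda>j. g (Suc j)"] Suc.prems assms(3) by (simp add: val_mult[OF valuation_res])
  also have "\<dots> = (MIN j\<in>{..n}. res b \<delta> (g (Suc j)) + Fin (nat_times (Suc j) \<gamma>))"
    unfolding Min_add_const[symmetric] nat_times_Suc 
    by (simp add: add.commute[of \<gamma>] add.assoc)
  finally show ?case unfolding Min_Suc_shift by (simp add: min.commute flip: zero_extended_def)
qed

section \<open>Augmentations\<close>

text \<open>
  Going from radius \<open>\<delta>\<close> to \<open>\<delta>'\<close> leaves polynomials of degree below that of \<open>b\<close> unchanged, as their
  roots are no closer than \<open>\<delta>\<close>, and strictly increases the value of the minimal polynomial of \<open>b\<close>.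
  The expansion formula at \<open>\<delta>'\<close> then is the definition of the augmented valuation.
\<close>
lemma augmented_res:
  assumes "minpoly b \<phi>" "Fin \<delta>' \<le> v (a - b)" "\<delta> < \<delta>'" "apart a \<delta> (degK emb b)" 
    and "res a \<delta>' \<phi> = Fin \<gamma>"
  shows "augmented_valuation (res a \<delta>) \<phi> \<gamma> (res a \<delta>')"
proof -
  have less: "Fin \<delta> < v (a - b)" 
    using assms(2,3) by (meson less_extended_simps(1) less_le_trans)
  have c: "res a \<delta> = res b \<delta>" "res a \<delta>' = res b \<delta>'"
    using res_center less assms(2) less_imp_le by blast+
  have ap: "apart b \<delta> (degK emb b)" by (rule apart_center[OF assms(4) less])
  hence ap': "apart b \<delta>' (degK emb b)" using apart_mono assms(3) by simp
  have "res a \<delta> \<phi> < Fin \<gamma>"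
    using res_strict_mono[OF minpoly_nz[OF assms(1)] _ assms(3,2)] assms(1,5) by (simp add: minpoly_def)
  moreover have "res b \<delta>' (\<Sum>j\<le>n. g j * \<phi> ^ j) = (MIN j\<in>{..n}. res b \<delta> (g j) + Fin (nat_times j \<gamma>))"
    if g: "\<forall>j\<le>n. degree (g j) < degree \<phi>" for n g
  proof -
    have deg: "\<forall>j\<le>n. degree (g j) < degK emb b" using g assms(1) by (simp add: minpoly_def)
    have "(\<lambda>j. res b \<delta> (g j) + Fin (nat_times j \<gamma>)) ` {..n} =
        (\<lambda>j. res b \<delta>' (g j) + Fin (nat_times j \<gamma>)) ` {..n}"
      using deg res_low_degree[OF ap] res_low_degree[OF ap'] by (intro image_cong) auto
    thus ?thesis using res_expansion[OF assms(1) ap' _ deg] assms(5) c by simp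
  qed
  ultimately show ?thesis
    unfolding augmented_valuation_def c using key_polynomial_minpoly[OF assms(1) ap] by simp
qed

lemma eventually_above:
  assumes "finite X" "A \<noteq> {}" "\<forall>x\<in>X. \<exists>\<alpha>\<in>A. (x::'g extended) < Fin \<alpha>"
  shows "\<exists>\<alpha>\<in>A. \<forall>x\<in>X. x < Fin \<alpha>"
  using assms(1,3)
proof (induction X rule: finite_induct)
  case empty thus ?case using assms(2) by auto
next
  case (insert x X)
  then obtain \<alpha> \<beta> where "\<alpha> \<in> A" "\<forall>x\<in>X. x < Fin \<alpha>" "\<beta> \<in> A" "x < Fin \<beta>" by auto
  moreover have "Fin \<alpha> \<le> Fin (max \<alpha> \<beta>)" "Fin \<beta> \<le> Fin (max \<alpha> \<beta>)" by simp_all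
  moreover have "max \<alpha> \<beta> \<in> A" using calculation by (simp add: max_def)
  ultimately show ?case by (metis insert_iff less_le_trans)
qed

text \<open>
  A polynomial has finitely many roots, so the balls leave all of them from some radius on.
\<close>
lemma res_stabilizes:
  assumes "A \<noteq> {}" "\<And>c. f \<noteq> 0 \<Longrightarrow> evalK f c = 0 \<Longrightarrow> \<exists>\<alpha>\<in>A. v (a - c) < Fin \<alpha>"
  shows "\<exists>\<alpha>\<in>A. \<forall>\<beta>\<ge>\<alpha>. res a \<beta> f = v (evalK f a)"
proof -
  have "\<exists>\<alpha>\<in>A. \<forall>c. f \<noteq> 0 \<longrightarrow> evalK f c = 0 \<longrightarrow> v (a - c) < Fin \<alpha>"
  proof (cases "f = 0")
    case False
    hence "finite ((\<lambda>c. v (a - c)) ` {c. evalK f c = 0})"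
      by (simp add: poly_roots_finite map_emb_eq_0_iff[OF emb])
    from eventually_above[OF this assms(1)] assms(2) False show ?thesis by auto
  qed (use assms(1) in auto)
  then obtain \<alpha> where \<alpha>: "\<alpha> \<in> A" "\<And>c. f \<noteq> 0 \<Longrightarrow> evalK f c = 0 \<Longrightarrow> v (a - c) < Fin \<alpha>" by blast
  have "res a \<beta> f = v (evalK f a)" if "\<alpha> \<le> \<beta>" for \<beta>
  proof (rule res_eq_eval)
    fix c assume "f \<noteq> 0" "evalK f c = 0"
    hence "v (a - c) < Fin \<alpha>" by (rule \<alpha>(2))
    also have "\<dots> \<le> Fin \<beta>" using that by simp
    finally show "v (a - c) \<le> Fin \<beta>" by simp
  qed
  thus ?thesis using \<alpha>(1) by blast
qed

lemma increasing_has_root: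
  assumes "A \<noteq> {}" "\<forall>\<alpha>\<in>A. \<exists>\<beta>\<in>A. \<alpha> < \<beta>" "f \<in> increasing_polys A (res a)"
  shows "\<exists>c. f \<noteq> 0 \<and> evalK f c = 0 \<and> (\<forall>\<alpha>\<in>A. Fin \<alpha> \<le> v (a - c))"
proof (rule ccontr)
  assume "\<not> ?thesis"
  hence "\<exists>\<alpha>\<in>A. v (a - c) < Fin \<alpha>" if "f \<noteq> 0" "evalK f c = 0" for c using that by (auto simp: not_le)
  from res_stabilizes[OF assms(1) this] 
  obtain \<alpha> where \<alpha>: "\<alpha> \<in> A" "\<forall>\<beta>\<ge>\<alpha>. res a \<beta> f = v (evalK f a)" by auto
  then obtain \<beta> where \<beta>: "\<beta> \<in> A" "\<alpha> < \<beta>" using assms(2) by blast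
  hence "res a \<alpha> f < res a \<beta> f" using assms(3) \<alpha>(1) by (auto simp: increasing_polys_def)
  thus False using \<alpha>(2) \<beta>(2) by simp
qed

text \<open>
  A polynomial whose values increase along the whole family has a root in all of its balls, hence
  has at least the degree of \<open>b\<close>; the minimal polynomial of \<open>b\<close> is such a polynomial. Below this
  degree values stabilise, so the suprema in the limit augmentation are values for the radius \<open>\<delta>'\<close>.
\<close>
lemma limit_augmented_res:
  assumes A: "A \<noteq> {}" "\<forall>\<alpha>\<in>A. \<exists>\<beta>\<in>A. \<alpha> < \<beta>" "\<forall>\<alpha>\<in>A. \<alpha> < \<delta>'"
    and \<phi>: "minpoly b \<phi>" "Fin \<delta>' \<le> v (a - b)" "res a \<delta>' \<phi> = Fin \<gamma>"
    and low: "\<And>c. degK emb c < degK emb b \<Longrightarrow> \<exists>\<alpha>\<in>A. v (a - c) < Fin \<alpha>"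
  shows "limit_augmented_valuation A (res a) \<phi> \<gamma> (res a \<delta>')"
proof -
  have root: "evalK \<phi> b = 0" "degree \<phi> = degK emb b" using \<phi>(1) by (auto simp: minpoly_def)
  have above: "Fin \<alpha> \<le> v (a - b)" if "\<alpha> \<in> A" for \<alpha>
    using A(3) that \<phi>(2) by (meson less_eq_extended.simps(1) less_imp_le order_trans)
  have strict: "res a \<alpha> \<phi> < res a \<beta> \<phi>" if "\<alpha> < \<beta>" "Fin \<beta> \<le> v (a - b)" for \<alpha> \<beta>
    using res_strict_mono[OF minpoly_nz[OF \<phi>(1)] root(1) that] .
  have "limit_key_polynomial A (res a) \<phi>"
    unfolding limit_key_polynomial_def
  proof (intro conjI ballI)
    show "lead_coeff \<phi> = 1" using \<phi>(1) unfolding minpoly_def by blast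
    show "\<phi> \<in> increasing_polys A (res a)"
      using strict above by (auto simp: increasing_polys_def)
    fix f assume "f \<in> increasing_polys A (res a)"
    from increasing_has_root[OF A(1,2) this] obtain c where
      c: "f \<noteq> 0" "evalK f c = 0" "\<forall>\<alpha>\<in>A. Fin \<alpha> \<le> v (a - c)" by blast
    hence "degK emb b \<le> degK emb c" using low[of c] by (auto simp: not_less[symmetric])
    also have "\<dots> \<le> degree f" by (rule degK_le[OF emb c(1,2)])
    finally show "degree \<phi> \<le> degree f" using root(2) by simp
  qed
  moreover have "\<forall>\<alpha>\<in>A. res a \<alpha> \<phi> < Fin \<gamma>"
    using strict A(3) \<phi>(2) unfolding \<phi>(3)[symmetric] by blast
  moreover have "\<exists>s. (\<forall>j\<le>n. isLub UNIV ((\<lambda>\<alpha>. res a \<alpha> (g j)) ` A) (s j)) \<and>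
      res a \<delta>' (\<Sum>j\<le>n. g j * \<phi> ^ j) = (MIN j\<in>{..n}. s j + Fin (nat_times j \<gamma>))"
    if g: "\<forall>j\<le>n. degree (g j) < degree \<phi>" for n g
  proof (intro exI[of _ "\<lambda>j. res a \<delta>' (g j)"] conjI allI impI)
    fix j assume "j \<le> n"
    hence "\<exists>\<alpha>\<in>A. v (a - c) < Fin \<alpha>" if "g j \<noteq> 0" "evalK (g j) c = 0" for c
      using low g root(2) degK_le[OF emb that] by (metis le_less_trans)
    from res_stabilizes[OF A(1) this] obtain \<alpha> where 
      \<alpha>: "\<alpha> \<in> A" "\<forall>\<beta>\<ge>\<alpha>. res a \<beta> (g j) = v (evalK (g j) a)" by auto
    hence "res a \<delta>' (g j) = res a \<alpha> (g j)" using A(3) by (simp add: less_imp_le)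
    thus "isLub UNIV ((\<lambda>\<alpha>. res a \<alpha> (g j)) ` A) (res a \<delta>' (g j))"
      using \<alpha>(1) A(3) res_mono[of _ \<delta>' a "g j"]
      by (auto simp: isLub_def isUb_def leastP_def setle_def setge_def less_imp_le)
  next
    have "apart b \<delta>' (degK emb b)"
      unfolding apart_def
    proof (intro allI impI)
      fix c assume "degK emb c < degK emb b"
      from low[OF this] obtain \<alpha> where \<alpha>: "\<alpha> \<in> A" "v (a - c) < Fin \<alpha>" by blast
      have "min (v (a - b)) (v (b - c)) \<le> v (a - c)"
        using val_add[OF v, of "a - b" "b - c"] by simp
      hence "v (b - c) < Fin \<alpha>" using above[OF \<alpha>(1)] \<alpha>(2) by (auto simp: min_def split: if_splits)
      moreover have "Fin \<alpha> \<le> Fin \<delta>'" using A(3) \<alpha>(1) by (simp add: less_imp_le)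
      ultimately show "v (b - c) \<le> Fin \<delta>'" by (meson less_imp_le less_le_trans)
    qed
    thus "res a \<delta>' (\<Sum>j\<le>n. g j * \<phi> ^ j) = (MIN j\<in>{..n}. res a \<delta>' (g j) + Fin (nat_times j \<gamma>))"
      using res_expansion[OF \<phi>(1)] \<phi>(3) g root(2) res_center[OF \<phi>(2)] by simp
  qed
  ultimately show ?thesis unfolding limit_augmented_valuation_def by blast
qed

text \<open>
  Needed for the monotonicity of the \<open>\<gamma>\<^sub>\<alpha>\<close> of a continuous family. The two minimal polynomials are
  unrelated, but since both are monic of the same degree, their difference is a remainder, and by
  non-cancellation \<open>\<phi>'\<close> has at least the value of \<open>\<phi>\<close> already at radius \<open>\<delta>\<close>.
\<close>
lemma res_minpoly_mono:
  assumes "minpoly b \<phi>" "minpoly b' \<phi>'" "degK emb b = degK emb b'"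
    and "\<delta> < \<delta>'" "Fin \<delta>' \<le> v (a - b')" "apart a \<delta> (degK emb b)"
  shows "res a \<delta> \<phi> < res a \<delta>' \<phi>'"
proof -
  have less: "Fin \<delta> < v (a - b')"
    using assms(4,5) by (meson less_extended_simps(1) less_le_trans)
  have center: "res a \<delta> = res b' \<delta>" by (rule res_center[OF less_imp_le[OF less]])
  have m: "lead_coeff \<phi> = 1" "degree \<phi> = degK emb b'" "lead_coeff \<phi>' = 1" "degree \<phi>' = degK emb b'"
    using assms(1-3) by (auto simp: minpoly_def)
  have "degree (\<phi> - \<phi>') \<le> degK emb b'" using m by (intro degree_diff_le) auto
  moreover have "coeff (\<phi> - \<phi>') (degK emb b') = 0" using m by (metis coeff_diff diff_self)
  ultimately have deg: "degree (\<phi> - \<phi>') < degK emb b'"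
    using degK_pos[OF emb, of b'] by (metis degree_0 leading_coeff_0_iff nat_less_le)
  have "res a \<delta> \<phi> = res b' \<delta> (1 * \<phi>' + (\<phi> - \<phi>'))" by (simp add: center)
  also have "\<dots> \<le> res b' \<delta> (1 * \<phi>')"
    using res_division[OF assms(2) _ deg, of \<delta> 1] apart_center[OF assms(6) less] assms(3) by simp
  also have "\<dots> = res a \<delta> \<phi>'" by (simp add: center)
  also have "\<dots> < res a \<delta>' \<phi>'"
    using res_strict_mono[OF minpoly_nz[OF assms(2)] _ assms(4,5)] assms(2) by (simp add: minpoly_def)
  finally show ?thesis .
qed

lemma res_minpoly_Fin: "minpoly b \<phi> \<Longrightarrow> \<exists>\<gamma>. res a \<delta> \<phi> = Fin \<gamma>"
  using val_Fin[OF valuation_res] minpoly_nz by blast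

lemma continuous_res:
  assumes A: "A \<noteq> {}" "\<forall>\<alpha>\<in>A. \<exists>\<beta>\<in>A. \<alpha> < \<beta>" "\<forall>\<alpha>\<in>A. \<sigma> < \<alpha>"
    and deg: "\<And>\<alpha>. \<alpha> \<in> A \<Longrightarrow> \<exists>b. Fin \<alpha> \<le> v (a - b) \<and> degK emb b = d"
    and ap: "apart a \<sigma> d"
    and low: "\<And>c. degK emb c \<le> d \<Longrightarrow> \<exists>\<alpha>\<in>A. v (a - c) < Fin \<alpha>"
  shows "continuous_admissible_family (res a \<sigma>) A (res a) d"
proof -
  from deg obtain b where b: "\<And>\<alpha>. \<alpha> \<in> A \<Longrightarrow> Fin \<alpha> \<le> v (a - b \<alpha>) \<and> degK emb (b \<alpha>) = d"
    by metis
  have "\<forall>\<alpha>. \<exists>\<phi>. minpoly (b \<alpha>) \<phi>" using minpoly_exists by blast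
  then obtain \<phi> where \<phi>: "\<And>\<alpha>. minpoly (b \<alpha>) (\<phi> \<alpha>)" by metis
  hence "\<forall>\<alpha>. \<exists>\<gamma>. res a \<alpha> (\<phi> \<alpha>) = Fin \<gamma>" using res_minpoly_Fin by blast
  then obtain \<gamma> where \<gamma>: "\<And>\<alpha>. res a \<alpha> (\<phi> \<alpha>) = Fin (\<gamma> \<alpha>)" by metis
  have aug: "augmented_valuation (res a \<alpha>) (\<phi> \<beta>) (\<gamma> \<beta>) (res a \<beta>)" 
    if "\<beta> \<in> A" "\<alpha> < \<beta>" "\<sigma> \<le> \<alpha>" for \<alpha> \<beta>
    using augmented_res[OF \<phi> _ that(2) _ \<gamma>] b[OF that(1)] apart_mono[OF ap that(3)] by simp
  have "degree (\<phi> \<alpha>) = d" if "\<alpha> \<in> A" for \<alpha> using \<phi>[of \<alpha>] b[OF that] by (simp add: minpoly_def)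
  moreover have "strict_mono_on A \<gamma>"
  proof (rule strict_mono_onI)
    fix \<alpha> \<beta> assume *: "\<alpha> \<in> A" "\<beta> \<in> A" "\<alpha> < \<beta>"
    hence "res a \<alpha> (\<phi> \<alpha>) < res a \<beta> (\<phi> \<beta>)"
      using b apart_mono[OF ap, of \<alpha>] A(3)
      by (intro res_minpoly_mono[OF \<phi> \<phi>]) (auto simp: less_imp_le)
    thus "\<gamma> \<alpha> < \<gamma> \<beta>" by (simp add: \<gamma>)
  qed
  moreover have "d < degree f" if f: "f \<in> increasing_polys A (res a)" for f
  proof -
    from increasing_has_root[OF A(1,2) f] obtain c where
      c: "f \<noteq> 0" "evalK f c = 0" "\<forall>\<alpha>\<in>A. Fin \<alpha> \<le> v (a - c)" by blast
    hence "\<not> degK emb c \<le> d" using low[of c] by (auto simp: not_less[symmetric])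
    thus ?thesis using degK_le[OF emb c(1,2)] by simp
  qed
  ultimately show ?thesis
    unfolding continuous_admissible_family_def using A aug 
    by (intro conjI exI[of _ \<phi>] exI[of _ \<gamma>]) (auto simp: less_imp_le)
qed

lemma map_emb_pcompose: 
  "pcompose (map_poly emb f) (map_poly emb g) = map_poly emb (pcompose f g)"
  by (induction f) (simp_all add: pcompose_pCons map_emb_pCons[OF emb] map_emb_add[OF emb] map_emb_mult[OF emb])

lemma res_emb:
  assumes "extends_valuation emb \<nu> v"
  shows "res (emb c) \<delta> = omega \<nu> c \<delta>"
proof
  fix f
  have "pcompose (map_poly emb f) [:emb c, 1:] = map_poly emb (pcompose f [:c, 1:])"
    using map_emb_pcompose[of f "[:c, 1:]"] by (simp add: map_emb_pCons[OF emb] emb_1[OF emb])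
  thus "res (emb c) \<delta> f = omega \<nu> c \<delta> f"
    using assms by (simp add: restrict_poly_def omega_def degree_map_emb[OF emb] coeff_map_emb[OF emb]
        extends_valuation_def)
qed

end
end

section \<open>Degrees of balls\<close>

context
  fixes emb :: "'k::field \<Rightarrow> 'l::alg_closed_field"
    and v :: "'l \<Rightarrow> 'g::linordered_ab_group_add extended"
  assumes emb: "algebraic_closure_embedding emb" and v: "valuation v"
begin

abbreviation degB :: "'l \<Rightarrow> 'g \<Rightarrow> nat" where
  "degB a \<delta> \<equiv> degK_set emb (vball v a \<delta>)"

lemma degB_attained: "\<exists>b. Fin \<delta> \<le> v (a - b) \<and> degK emb b = degB a \<delta>"
proof -
  have "a \<in> vball v a \<delta>" using v by (simp add: vball_def)
  hence "degB a \<delta> \<in> degK emb ` vball v a \<delta>"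
    unfolding degK_set_def by (intro Inf_nat_def1) auto
  thus ?thesis by (auto simp: vball_def)
qed

lemma degB_le: "Fin \<delta> \<le> v (a - c) \<Longrightarrow> degB a \<delta> \<le> degK emb c"
  unfolding degK_set_def by (rule wellorder_Inf_le1) (auto simp: vball_def)

lemma degB_pos: "degB a \<delta> > 0"
  using degB_attained degK_pos[OF emb] by metis

lemma degB_mono: "\<delta> \<le> \<delta>' \<Longrightarrow> degB a \<delta> \<le> degB a \<delta>'"
  using degB_attained[of \<delta>' a] degB_le[of \<delta> a] by (metis less_eq_extended.simps(1) order_trans)

text \<open>
  An element of degree below that of a ball \<open>B(a, \<delta>)\<close> has a finite distance to \<open>a\<close>, because \<open>a\<close>
  itself lies in the ball. So its distance is a radius in the value group, of the kind collected
  in \<open>R\<^sub>K\<close>.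
\<close>
lemma low_degree_radius:
  assumes "degK emb c < degB a \<delta>"
  obtains g where "g \<in> value_group v" "v (a - c) = Fin g" "g < \<delta>" "degB a g \<le> degK emb c"
proof -
  have "\<not> Fin \<delta> \<le> v (a - c)" using assms degB_le[of \<delta> a c] by auto
  hence less: "v (a - c) < Fin \<delta>" by simp
  hence "a - c \<noteq> 0" using v by auto
  then obtain g where g: "v (a - c) = Fin g" using val_Fin[OF v] by blast
  hence "g \<in> value_group v" using \<open>a - c \<noteq> 0\<close> unfolding value_group_def by blast
  thus ?thesis using that[of g] g less degB_le[of g a c] by simp
qed

lemma low_degree_RK:
  assumes "degK emb c < d" "d \<le> degB a \<delta>"
  obtains g where "g \<in> RK emb v a d" "v (a - c) = Fin g"
  using assms low_degree_radius[of c a \<delta>] by (metis (no_types, lifting) RK_def le_less_trans less_le_trans mem_Collect_eq)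

lemma RK_less: "g \<in> RK emb v a (degB a \<delta>) \<Longrightarrow> g < \<delta>"
  using degB_mono[of \<delta> g a] by (auto simp: RK_def not_less[symmetric])

lemma RK_nonempty: "1 < degB a \<delta> \<Longrightarrow> RK emb v a (degB a \<delta>) \<noteq> {}"
  using low_degree_RK[of "emb 0" "degB a \<delta>" a \<delta>] degK_emb[OF emb, of 0] by auto

end

section \<open>Gluing descents\<close>

text \<open>
  A descent from \<open>s\<close> down to the bottom of \<open>I\<close> can be continued above \<open>s\<close>: the sets \<open>R\<^sub>K\<close> depend
  only on the degree reached, and not on the part of the family that has already been built.
\<close>
lemma descent_glue:
  assumes "descent emb w a I r U d"
    and s: "s \<in> I" "\<forall>i\<in>I. i \<le> s"
    and T: "s \<in> T" "\<forall>t\<in>T. s \<le> t"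
    and upper: "descent emb w a (I \<union> T) r T (degK_set emb (vball w a (r s)))"
  shows "s \<in> U \<and> U \<subseteq> I \<and> descent emb w a (I \<union> T) r (U \<union> T) d"
  using assms(1)
proof induction
  case (start m)
  hence "m = s" using s by (auto intro: antisym)
  thus ?case using T(1) s(1) upper by (simp add: insert_absorb)
next
  case (predecessor U d \<rho> p)
  hence p: "p < s" by auto
  have "{j \<in> I \<union> T. p < j} = U \<union> T"
    using predecessor.hyps(6) p T(2) by (auto intro: less_le_trans)
  hence "descent emb w a (I \<union> T) r (insert p (U \<union> T)) (degK_set emb (vball w a \<rho>))"
    using predecessor by (intro descent.predecessor[of emb w a "I \<union> T" r "U \<union> T" d \<rho> p]) auto
  thus ?case using predecessor by simp
next
  case (limit U d S d')
  have T': "t = s" if "t \<in> T" "t \<in> I" for t using that s(2) T(2) by (auto intro: antisym)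
  have "descent emb w a (I \<union> T) r (S \<union> (U \<union> T)) d'"
  proof (rule descent.limit[of emb w a "I \<union> T" r "U \<union> T" d S d'])
    show "S \<subseteq> I \<union> T - (U \<union> T)" using limit.hyps(4) limit.IH T' by blast
    show "\<forall>j\<in>I \<union> T - (U \<union> T). \<exists>s\<in>S. j \<le> s" using limit.hyps(10) by blast
    show "\<forall>j\<in>I \<union> T. \<forall>s\<in>S. s \<le> j \<longrightarrow> j \<in> S \<union> (U \<union> T)" using limit.hyps(11) by blast
  qed (use limit in auto)
  thus ?case using limit by (auto simp: Un_assoc)
qed

section \<open>Building admissible families from below\<close>

text \<open>
  To append a valuation at the top one needs the greatest member \<open>m\<close> and the degree \<open>d\<close> of its
  defining polynomial, which an admissible family does not record; the discrete parts are finite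
  here because degrees are bounded by \<open>d\<close>.
\<close>
locale tower =
  fixes \<nu> :: "'k::field \<Rightarrow> 'g::linordered_ab_group_add extended"
    and M :: "'i::linorder \<Rightarrow> 'k poly \<Rightarrow> 'g extended"
    and I :: "'i set" and m :: 'i and d N :: nat and n :: "nat \<Rightarrow> nat"
    and e :: "nat \<Rightarrow> nat \<Rightarrow> 'i" and C :: "nat \<Rightarrow> 'i set"
    and \<phi> :: "nat \<Rightarrow> nat \<Rightarrow> 'k poly" and \<gamma> :: "nat \<Rightarrow> nat \<Rightarrow> 'g"
  assumes N_pos: "1 \<le> N" and n_pos: "\<forall>j\<in>{1..N}. 1 \<le> n j"
    and I_eq: "I = (\<Union>j\<in>{1..N}. e j ` {1..n j} \<union> C j)"
    and e_mono: "\<forall>j\<in>{1..N}. strict_mono_on {1..n j} (e j)"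
    and e_less_C: "\<forall>j\<in>{1..N}. \<forall>l\<in>{1..n j}. \<forall>\<alpha>\<in>C j. e j l < \<alpha>"
    and blocks: "\<forall>j\<in>{1..N}. \<forall>j'\<in>{1..N}. j < j' \<longrightarrow>
      (\<forall>x\<in>e j ` {1..n j} \<union> C j. \<forall>y\<in>e j' ` {1..n j'} \<union> C j'. x < y)"
    and first: "\<exists>c. \<phi> 1 1 = [:- c, 1:] \<and> M (e 1 1) = omega \<nu> c (\<gamma> 1 1)"
    and discrete: "\<forall>j\<in>{1..N}. \<forall>l. l \<in> {1..n j} \<and> Suc l \<in> {1..n j} \<longrightarrow>
      augmented_valuation (M (e j l)) (\<phi> j (Suc l)) (\<gamma> j (Suc l)) (M (e j (Suc l))) \<and>
      degree (\<phi> j l) < degree (\<phi> j (Suc l))"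
    and continuous: "\<forall>j\<in>{1..N}. C j = {} \<or>
      continuous_admissible_family (M (e j (n j))) (C j) M (degree (\<phi> j (n j)))"
    and limit: "\<forall>j\<in>{1..N}. Suc j \<in> {1..N} \<longrightarrow> C j \<noteq> {} \<and>
      limit_augmented_valuation (C j) M (\<phi> (Suc j) 1) (\<gamma> (Suc j) 1) (M (e (Suc j) 1))"
    and C_last: "C N = {}" and e_last: "e N (n N) = m" and degree_last: "degree (\<phi> N (n N)) = d"
    and top: "\<forall>i\<in>I. i \<le> m"

definition has_tower ::
  "('k::field \<Rightarrow> 'g::linordered_ab_group_add extended) \<Rightarrow> ('i::linorder \<Rightarrow> 'k poly \<Rightarrow> 'g extended) \<Rightarrow>
   'i set \<Rightarrow> 'i \<Rightarrow> nat \<Rightarrow> bool" where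
  "has_tower \<nu> M I m d \<longleftrightarrow> (\<exists>N n e C \<phi> \<gamma>. tower \<nu> M I m d N n e C \<phi> \<gamma>)"

lemma has_tower_top: "has_tower \<nu> M I m d \<Longrightarrow> i \<in> I \<Longrightarrow> i \<le> m"
  unfolding has_tower_def using tower.top by blast

lemma tower_admissible:
  assumes "has_tower \<nu> M I m d" "\<forall>i\<in>I. valuation (M i)"
  shows "admissible_family \<nu> I M"
proof -
  from assms(1) obtain N n e C \<phi> \<gamma> where "tower \<nu> M I m d N n e C \<phi> \<gamma>"
    unfolding has_tower_def by blast
  then interpret T: tower \<nu> M I m d N n e C \<phi> \<gamma> .
  have Max: "Max {1..n j} = n j" if "j \<in> {1..N}" for j
    using T.n_pos that by (intro Max_eqI) auto
  have range: "index_range {1..N}" "\<forall>j\<in>{1..N}. index_range {1..n j}"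
    using T.N_pos T.n_pos unfolding index_range_def by blast+
  show ?thesis
    unfolding admissible_family_def
  proof (intro conjI exI[of _ "{1..N}"] exI[of _ "\<lambda>j. {1..n j}"] exI[of _ e] exI[of _ C]
      exI[of _ \<phi>] exI[of _ \<gamma>])
    show "\<forall>j\<in>{1..N}. C j = {} \<or> finite {1..n j} \<and>
       continuous_admissible_family (M (e j (Max {1..n j}))) (C j) M (degree (\<phi> j (Max {1..n j})))"
      using T.continuous Max by simp
    show "\<forall>j\<in>{1..N}. Suc j \<in> {1..N} \<longrightarrow> finite {1..n j} \<and> C j \<noteq> {} \<and>
       limit_augmented_valuation (C j) M (\<phi> (Suc j) 1) (\<gamma> (Suc j) 1) (M (e (Suc j) 1))"
      using T.limit by simp
  qed (fact assms(2) range T.I_eq T.e_mono T.e_less_C T.blocks T.first T.discrete)+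
qed

lemma tower_singleton:
  assumes "M m = omega \<nu> c \<delta>"
  shows "has_tower \<nu> M {m} m 1"
proof -
  have "tower \<nu> M {m} m 1 1 (\<lambda>_. 1) (\<lambda>_ _. m) (\<lambda>_. {}) (\<lambda>_ _. [:- c, 1:]) (\<lambda>_ _. \<delta>)"
    by unfold_locales (auto simp: assms strict_mono_on_def)
  thus ?thesis unfolding has_tower_def by blast
qed

text \<open>
  The new valuation prolongs the last discrete part.
\<close>
lemma tower_augment:
  assumes "has_tower \<nu> M I s d" "s < m" "augmented_valuation (M s) \<psi> \<epsilon> (M m)" "d < degree \<psi>"
  shows "has_tower \<nu> M (insert m I) m (degree \<psi>)"
proof -
  from assms(1) obtain N n e C \<phi> \<gamma> where "tower \<nu> M I s d N n e C \<phi> \<gamma>"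
    unfolding has_tower_def by blast
  then interpret T: tower \<nu> M I s d N n e C \<phi> \<gamma> .
  have top: "\<forall>i\<in>I. i < m" using T.top assms(2) by (auto intro: le_less_trans)
  define n' where "n' = n(N := Suc (n N))"
  define e' where "e' = e(N := (e N)(Suc (n N) := m))"
  define \<phi>' where "\<phi>' = \<phi>(N := (\<phi> N)(Suc (n N) := \<psi>))"
  define \<gamma>' where "\<gamma>' = \<gamma>(N := (\<gamma> N)(Suc (n N) := \<epsilon>))"
  have N: "N \<in> {1..N}" using T.N_pos by simp
  have block: "e' j ` {1..n' j} \<union> C j = (if j = N then insert m (e j ` {1..n j}) else e j ` {1..n j} \<union> C j)"
    for j using T.C_last by (auto simp: e'_def n'_def image_iff)
  have inI: "x \<in> I" if "j \<in> {1..N}" "x \<in> e j ` {1..n j} \<union> C j" for x j 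
    unfolding T.I_eq using that by blast
  have old: "e' j l = e j l" "\<phi>' j l = \<phi> j l" "\<gamma>' j l = \<gamma> j l" if "l \<le> n j" for j l
    using that by (auto simp: e'_def \<phi>'_def \<gamma>'_def)
  have new: "e' N (Suc (n N)) = m" "\<phi>' N (Suc (n N)) = \<psi>" "\<gamma>' N (Suc (n N)) = \<epsilon>" "n' N = Suc (n N)"
    by (simp_all add: e'_def \<phi>'_def \<gamma>'_def n'_def)
  have n'_other: "n' j = n j" if "j \<noteq> N" for j using that by (simp add: n'_def)
  have "tower \<nu> M (insert m I) m (degree \<psi>) N n' e' C \<phi>' \<gamma>'"
  proof
    show "\<forall>i\<in>insert m I. i \<le> m" using top by (auto simp: less_imp_le)
    show "\<forall>j\<in>{1..N}. 1 \<le> n' j" using T.n_pos by (simp add: n'_def)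
    show "insert m I = (\<Union>j\<in>{1..N}. e' j ` {1..n' j} \<union> C j)"
      unfolding block T.I_eq using N T.C_last by (auto split: if_splits)
    show "\<forall>j\<in>{1..N}. strict_mono_on {1..n' j} (e' j)"
    proof
      fix j assume j: "j \<in> {1..N}"
      show "strict_mono_on {1..n' j} (e' j)"
      proof (rule strict_mono_onI)
        fix l l' assume l: "l \<in> {1..n' j}" "l' \<in> {1..n' j}" "l < l'"
        hence ln: "l \<le> n j" by (auto simp: n'_def split: if_splits)
        show "e' j l < e' j l'"
        proof (cases "l' \<le> n j")
          case True
          thus ?thesis using l ln T.e_mono j by (auto simp: old strict_mono_on_def)
        next
          case False
          hence "j = N" "l' = Suc (n N)" using l by (auto simp: n'_def split: if_splits)
          moreover have "e j l \<in> I" using inI[OF j] l(1) ln by auto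
          ultimately show ?thesis using top ln by (simp add: old new)
        qed
      qed
    qed
    show "\<forall>j\<in>{1..N}. \<forall>l\<in>{1..n' j}. \<forall>\<alpha>\<in>C j. e' j l < \<alpha>"
    proof (intro ballI)
      fix j l \<alpha> assume *: "j \<in> {1..N}" "l \<in> {1..n' j}" "\<alpha> \<in> C j"
      hence "j \<noteq> N" using T.C_last by auto
      thus "e' j l < \<alpha>" using * T.e_less_C by (simp add: n'_other old)
    qed
    show "\<forall>j\<in>{1..N}. \<forall>j'\<in>{1..N}. j < j' \<longrightarrow>
       (\<forall>x\<in>e' j ` {1..n' j} \<union> C j. \<forall>y\<in>e' j' ` {1..n' j'} \<union> C j'. x < y)"
    proof (intro ballI impI)
      fix j j' x y assume *: "j \<in> {1..N}" "j' \<in> {1..N}" "j < j'"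
        "x \<in> e' j ` {1..n' j} \<union> C j" "y \<in> e' j' ` {1..n' j'} \<union> C j'"
      hence "j \<noteq> N" by auto
      hence x: "x \<in> e j ` {1..n j} \<union> C j" using *(4) unfolding block by simp
      have "y = m \<or> y \<in> e j' ` {1..n j'} \<union> C j'" using *(5) unfolding block by (auto split: if_splits)
      thus "x < y"
      proof
        assume "y = m" thus ?thesis using top inI[OF *(1) x] by simp
      next
        assume "y \<in> e j' ` {1..n j'} \<union> C j'" thus ?thesis using T.blocks *(1-3) x by blast
      qed
    qed
    have "1 \<le> n 1" using T.N_pos T.n_pos by simp
    hence "e' 1 1 = e 1 1" "\<phi>' 1 1 = \<phi> 1 1" "\<gamma>' 1 1 = \<gamma> 1 1" by (simp_all add: old)
    thus "\<exists>c. \<phi>' 1 1 = [:- c, 1:] \<and> M (e' 1 1) = omega \<nu> c (\<gamma>' 1 1)"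
      using T.first by simp
    show "\<forall>j\<in>{1..N}. \<forall>l. l \<in> {1..n' j} \<and> Suc l \<in> {1..n' j} \<longrightarrow>
       augmented_valuation (M (e' j l)) (\<phi>' j (Suc l)) (\<gamma>' j (Suc l)) (M (e' j (Suc l))) \<and>
       degree (\<phi>' j l) < degree (\<phi>' j (Suc l))"
    proof (intro ballI allI impI)
      fix j l assume j: "j \<in> {1..N}" and l: "l \<in> {1..n' j} \<and> Suc l \<in> {1..n' j}"
      show "augmented_valuation (M (e' j l)) (\<phi>' j (Suc l)) (\<gamma>' j (Suc l)) (M (e' j (Suc l))) \<and>
        degree (\<phi>' j l) < degree (\<phi>' j (Suc l))"
      proof (cases "Suc l \<le> n j")
        case True
        thus ?thesis using T.discrete j l by (simp add: old)
      next
        case False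
        hence "j = N" "l = n N" using l by (auto simp: n'_def split: if_splits)
        thus ?thesis using assms(3,4) T.e_last T.degree_last by (simp add: old new)
      qed
    qed
    show "\<forall>j\<in>{1..N}. C j = {} \<or>
       continuous_admissible_family (M (e' j (n' j))) (C j) M (degree (\<phi>' j (n' j)))"
      using T.continuous T.C_last n'_other old by (metis order_refl)
    show "\<forall>j\<in>{1..N}. Suc j \<in> {1..N} \<longrightarrow> C j \<noteq> {} \<and>
       limit_augmented_valuation (C j) M (\<phi>' (Suc j) 1) (\<gamma>' (Suc j) 1) (M (e' (Suc j) 1))"
      using T.limit T.n_pos old[of 1] by simp
  qed (use T.N_pos T.C_last new in simp_all)
  thus ?thesis unfolding has_tower_def by blast
qed

text \<open>
  The set \<open>A\<close> becomes the continuous part of the last simple family, with base \<open>s\<close>, and the new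
  valuation opens another simple family.
\<close>
lemma tower_limit:
  assumes "has_tower \<nu> M I s d" "\<forall>\<alpha>\<in>A. s < \<alpha> \<and> \<alpha> < m" "A \<noteq> {}"
    and "continuous_admissible_family (M s) A M d"
    and "limit_augmented_valuation A M \<psi> \<epsilon> (M m)" 
  shows "has_tower \<nu> M (insert m (I \<union> A)) m (degree \<psi>)"
proof -
  from assms(1) obtain N n e C \<phi> \<gamma> where "tower \<nu> M I s d N n e C \<phi> \<gamma>"
    unfolding has_tower_def by blast
  then interpret T: tower \<nu> M I s d N n e C \<phi> \<gamma> .
  note top = T.top
  have sm: "s < m" using assms(2,3) by (meson ex_in_conv less_trans)
  define n' where "n' = n(Suc N := 1)"
  define e' where "e' = e(Suc N := \<lambda>_. m)"
  define C' where "C' = C(N := A, Suc N := {})"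
  define \<phi>' where "\<phi>' = \<phi>(Suc N := \<lambda>_. \<psi>)"
  define \<gamma>' where "\<gamma>' = \<gamma>(Suc N := \<lambda>_. \<epsilon>)"
  have N: "N \<in> {1..N}" using T.N_pos by simp
  have old: "n' j = n j" "e' j = e j" "\<phi>' j = \<phi> j" "\<gamma>' j = \<gamma> j" 
    "C' j = (if j = N then A else C j)" if "j \<in> {1..N}" for j
    using that by (auto simp: n'_def e'_def \<phi>'_def \<gamma>'_def C'_def)
  have new: "n' (Suc N) = 1" "e' (Suc N) = (\<lambda>_. m)" "\<phi>' (Suc N) = (\<lambda>_. \<psi>)" "\<gamma>' (Suc N) = (\<lambda>_. \<epsilon>)" 
    "C' (Suc N) = {}" by (simp_all add: n'_def e'_def \<phi>'_def \<gamma>'_def C'_def)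
  have ivl: "{1..Suc N} = insert (Suc N) {1..N}" by auto
  have inI: "x \<in> I" if "j \<in> {1..N}" "x \<in> e j ` {1..n j} \<union> C j" for x j 
    unfolding T.I_eq using that by blast
  have block: "e' j ` {1..n' j} \<union> C' j = (e j ` {1..n j} \<union> C j) \<union> (if j = N then A else {})"
    if "j \<in> {1..N}" for j using T.C_last old[OF that] by auto
  have block_new: "e' (Suc N) ` {1..n' (Suc N)} \<union> C' (Suc N) = {m}" by (simp add: new)
  have "tower \<nu> M (insert m (I \<union> A)) m (degree \<psi>) (Suc N) n' e' C' \<phi>' \<gamma>'"
  proof
    show "\<forall>i\<in>insert m (I \<union> A). i \<le> m" using top sm assms(2) by (auto intro: less_imp_le)
    show "\<forall>j\<in>{1..Suc N}. 1 \<le> n' j" using T.n_pos by (simp add: n'_def)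
    have "(\<Union>j\<in>{1..N}. e' j ` {1..n' j} \<union> C' j) = I \<union> A"
      unfolding T.I_eq using block N by (auto split: if_splits)
    thus "insert m (I \<union> A) = (\<Union>j\<in>{1..Suc N}. e' j ` {1..n' j} \<union> C' j)"
      unfolding ivl UN_insert block_new by simp
    show "\<forall>j\<in>{1..Suc N}. strict_mono_on {1..n' j} (e' j)"
      unfolding ivl using T.e_mono by (auto simp: old new strict_mono_on_def)
    show "\<forall>j\<in>{1..Suc N}. \<forall>l\<in>{1..n' j}. \<forall>\<alpha>\<in>C' j. e' j l < \<alpha>"
    proof (intro ballI)
      fix j l \<alpha> assume *: "j \<in> {1..Suc N}" "l \<in> {1..n' j}" "\<alpha> \<in> C' j"
      hence j: "j \<in> {1..N}" unfolding ivl by (auto simp: new)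
      show "e' j l < \<alpha>"
      proof (cases "j = N")
        case True
        have "l \<in> {1..n j}" using *(2) old(1)[OF j] by simp
        hence "e' j l \<in> I" using inI[OF j] old(2)[OF j] by auto
        moreover have "\<alpha> \<in> A" using *(3) old(5)[OF j] True by simp
        ultimately show ?thesis using top assms(2) by (auto intro: le_less_trans)
      next
        case False thus ?thesis using * T.e_less_C j by (simp add: old[OF j])
      qed
    qed
    show "\<forall>j\<in>{1..Suc N}. \<forall>j'\<in>{1..Suc N}. j < j' \<longrightarrow>
       (\<forall>x\<in>e' j ` {1..n' j} \<union> C' j. \<forall>y\<in>e' j' ` {1..n' j'} \<union> C' j'. x < y)"
    proof (intro ballI impI)
      fix j j' x y assume *: "j \<in> {1..Suc N}" "j' \<in> {1..Suc N}" "j < j'"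
        "x \<in> e' j ` {1..n' j} \<union> C' j" "y \<in> e' j' ` {1..n' j'} \<union> C' j'"
      hence j: "j \<in> {1..N}" by auto
      have x: "x \<in> e j ` {1..n j} \<union> C j \<or> x \<in> A \<and> j = N"
        using *(4) unfolding block[OF j] by (auto split: if_splits)
      show "x < y"
      proof (cases "j' = Suc N")
        case True
        hence "y = m" using *(5) by (simp add: new)
        thus ?thesis using x inI[OF j] top sm assms(2) by (auto intro: le_less_trans)
      next
        case False
        hence j': "j' \<in> {1..N}" "j \<noteq> N" using *(2,3) by auto
        hence xI: "x \<in> e j ` {1..n j} \<union> C j" using x by simp
        have "y \<in> e j' ` {1..n j'} \<union> C j' \<or> y \<in> A"
          using *(5) unfolding block[OF j'(1)] by (auto split: if_splits)
        thus ?thesis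
        proof
          assume "y \<in> A" 
          thus ?thesis using inI[OF j xI] top assms(2) by (auto intro: le_less_trans)
        next
          assume "y \<in> e j' ` {1..n j'} \<union> C j'" thus ?thesis using T.blocks j j'(1) *(3) xI by blast
        qed
      qed
    qed
    have "1 \<in> {1..N}" using T.N_pos by simp
    thus "\<exists>c. \<phi>' 1 1 = [:- c, 1:] \<and> M (e' 1 1) = omega \<nu> c (\<gamma>' 1 1)"
      using T.first by (simp only: old)
    show "\<forall>j\<in>{1..Suc N}. \<forall>l. l \<in> {1..n' j} \<and> Suc l \<in> {1..n' j} \<longrightarrow>
       augmented_valuation (M (e' j l)) (\<phi>' j (Suc l)) (\<gamma>' j (Suc l)) (M (e' j (Suc l))) \<and>
       degree (\<phi>' j l) < degree (\<phi>' j (Suc l))"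
      unfolding ivl using T.discrete by (auto simp: old new)
    show "\<forall>j\<in>{1..Suc N}. C' j = {} \<or>
       continuous_admissible_family (M (e' j (n' j))) (C' j) M (degree (\<phi>' j (n' j)))"
      unfolding ivl using T.continuous T.e_last T.degree_last assms(4) by (auto simp: old new)
    show "\<forall>j\<in>{1..Suc N}. Suc j \<in> {1..Suc N} \<longrightarrow> C' j \<noteq> {} \<and>
       limit_augmented_valuation (C' j) M (\<phi>' (Suc j) 1) (\<gamma>' (Suc j) 1) (M (e' (Suc j) 1))"
    proof (intro ballI impI)
      fix j assume "j \<in> {1..Suc N}" "Suc j \<in> {1..Suc N}"
      hence j: "j \<in> {1..N}" by auto
      show "C' j \<noteq> {} \<and>
        limit_augmented_valuation (C' j) M (\<phi>' (Suc j) 1) (\<gamma>' (Suc j) 1) (M (e' (Suc j) 1))"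
      proof (cases "j = N")
        case True
        hence "C' j = A" using old(5)[OF j] by simp
        thus ?thesis using assms(3,5) True by (simp add: new)
      next
        case False
        hence Sj: "Suc j \<in> {1..N}" using j by auto
        show ?thesis using T.limit j Sj False by (simp add: old(5)[OF j] old[OF Sj])
      qed
    qed
  qed (use T.N_pos new in simp_all)
  thus ?thesis unfolding has_tower_def by blast
qed

section \<open>The family\<close>

context
  fixes emb :: "'k::field \<Rightarrow> 'l::alg_closed_field"
    and v :: "'l \<Rightarrow> 'g::linordered_ab_group_add extended"
    and \<nu> :: "'k \<Rightarrow> 'g extended"
  assumes emb: "algebraic_closure_embedding emb" and v: "valuation v"
    and ext: "extends_valuation emb \<nu> v"
begin

text \<open>
  Radii serve as their own indices. Apart from the top radius \<open>m\<close>, which is arbitrary, all radii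
  come from \<open>R\<^sub>K\<close> and hence from the value group.
\<close>
lemma family_exists:
  "\<exists>I. m \<in> I \<and> I \<subseteq> insert m (value_group v) \<and>
     has_tower \<nu> (\<lambda>\<delta>. restrict_poly emb (omega v a \<delta>)) I m (degK_set emb (vball v a m)) \<and>
     descent emb v a I (\<lambda>\<delta>. \<delta>) I 1"
proof (induction "degK_set emb (vball v a m)" arbitrary: m rule: less_induct)
  case less
  let ?D = "\<lambda>\<delta>. degK_set emb (vball v a \<delta>)"
  let ?M = "\<lambda>\<delta>. restrict_poly emb (omega v a \<delta>)"
  let ?R = "RK emb v a (?D m)"
  obtain b where b: "Fin m \<le> v (a - b)" "degK emb b = ?D m"
    using degB_attained[OF emb v] by metis
  obtain \<psi> where \<psi>: "minpoly emb b \<psi>" using minpoly_exists[OF emb v] by blast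
  obtain \<epsilon> where \<epsilon>: "?M m \<psi> = Fin \<epsilon>" using res_minpoly_Fin[OF emb v \<psi>] by metis
  have deg: "degree \<psi> = ?D m" using degree_minpoly[OF emb v \<psi>] b(2) by simp
  have R_less: "\<rho> < m" "?D \<rho> < ?D m" "\<rho> \<in> value_group v" if "\<rho> \<in> ?R" for \<rho>
    using RK_less[OF emb v that] that by (auto simp: RK_def)
  have R_low: "\<exists>g\<in>?R. v (a - c) = Fin g" if "degK emb c < ?D m" for c
    using low_degree_RK[OF emb v that order_refl] by metis
  show ?case
  proof (cases "?D m = 1")
    case True
    \<comment> \<open>A ball of degree 1 has a centre in \<open>K\<close>.\<close>
    then obtain c where c: "b = emb c" using degK_1_imp[OF emb] b(2) by auto
    have "?M m = omega \<nu> c m" 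
      using res_center[OF emb v b(1)] res_emb[OF emb v ext] unfolding c by simp
    from tower_singleton[of ?M, OF this] descent.start[of m "{m}" emb v a "\<lambda>\<delta>. \<delta>"] True
    show ?thesis by (intro exI[of _ "{m}"]) simp
  next
    case False
    hence "1 < ?D m" using degB_pos[OF emb v, of a m] by linarith
    hence nonempty: "?R \<noteq> {}" by (rule RK_nonempty[OF emb v])
    show ?thesis
    proof (cases "\<exists>\<rho>\<in>?R. \<forall>\<sigma>\<in>?R. \<sigma> \<le> \<rho>")
      case True
      then obtain \<rho> where \<rho>: "\<rho> \<in> ?R" "\<forall>\<sigma>\<in>?R. \<sigma> \<le> \<rho>" by blast
      from less[OF R_less(2)[OF \<rho>(1)]] obtain I where I: "\<rho> \<in> I" "I \<subseteq> insert \<rho> (value_group v)"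
        "has_tower \<nu> ?M I \<rho> (?D \<rho>)" "descent emb v a I (\<lambda>\<delta>. \<delta>) I 1" by blast
      have top: "\<forall>i\<in>I. i \<le> \<rho>" using has_tower_top[OF I(3)] by blast
      have lt: "\<rho> < m" by (rule R_less(1)[OF \<rho>(1)])
      have "apart emb v a \<rho> (degK emb b)"
        unfolding apart_def b(2) using R_low \<rho>(2) by force
      hence "augmented_valuation (?M \<rho>) \<psi> \<epsilon> (?M m)"
        by (rule augmented_res[OF emb v \<psi> b(1) lt _ \<epsilon>])
      hence tower: "has_tower \<nu> ?M (insert m I) m (?D m)"
        using tower_augment[OF I(3) lt] R_less(2)[OF \<rho>(1)] deg by metis
      have eq: "insert m I = I \<union> {\<rho>, m}" using I(1) by auto
      have "descent emb v a (insert m I) (\<lambda>\<delta>. \<delta>) {m} (?D m)"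
        using top lt by (intro descent.start) (auto intro: less_imp_le le_less_trans)
      hence "descent emb v a (insert m I) (\<lambda>\<delta>. \<delta>) {\<rho>, m} (?D \<rho>)"
        by (rule descent.predecessor[OF _ \<rho>]) (use I(1) top lt in auto)
      from descent_glue[OF I(4,1) top _ _ this[unfolded eq]] lt
      have "descent emb v a (insert m I) (\<lambda>\<delta>. \<delta>) (insert m I) 1"
        unfolding eq by (simp add: less_imp_le)
      thus ?thesis using I(2) R_less(3)[OF \<rho>(1)] tower by (intro exI[of _ "insert m I"]) auto
    next
      case nomax: False
      hence up: "\<forall>\<rho>\<in>?R. \<exists>\<sigma>\<in>?R. \<rho> < \<sigma>" by (auto simp: not_le)
      obtain s where s: "s \<in> ?R" "\<forall>\<rho>\<in>?R. ?D \<rho> \<le> ?D s"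
      proof -
        obtain \<rho> where "\<rho> \<in> ?R" using nonempty by blast
        from ex_has_greatest_nat[of "\<lambda>\<rho>. \<rho> \<in> ?R", OF this, of ?D "?D m"] R_less(2) that
        show ?thesis by (auto intro: less_imp_le)
      qed
      from less[OF R_less(2)[OF s(1)]] obtain I where I: "s \<in> I" "I \<subseteq> insert s (value_group v)"
        "has_tower \<nu> ?M I s (?D s)" "descent emb v a I (\<lambda>\<delta>. \<delta>) I 1" by blast
      have top: "\<forall>i\<in>I. i \<le> s" using has_tower_top[OF I(3)] by blast
      \<comment> \<open>The cofinal family is cut off at \<open>s\<close>, which ends a discrete part and is the base of the
        continuous part \<open>A\<close>; otherwise the lowest block of radii could lack a first member.\<close>
      define S where "S = {\<sigma> \<in> ?R. s \<le> \<sigma>}"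
      define A where "A = {\<sigma> \<in> ?R. s < \<sigma>}"
      have S: "S = insert s A" using s(1) by (auto simp: S_def A_def)
      have beyond: "\<exists>\<alpha>\<in>A. g < \<alpha>" if "g \<in> ?R" for g
      proof -
        have "max g s \<in> ?R" using that s(1) by (simp add: max_def)
        then obtain \<alpha> where "\<alpha> \<in> ?R" "max g s < \<alpha>" using up by blast
        thus ?thesis by (auto simp: A_def)
      qed
      have A: "A \<noteq> {}" "\<forall>\<alpha>\<in>A. \<exists>\<beta>\<in>A. \<alpha> < \<beta>" "\<forall>\<alpha>\<in>A. s < \<alpha>" "\<forall>\<alpha>\<in>A. \<alpha> < m"
        using beyond s(1) R_less(1) by (auto simp: A_def)
      have D_const: "?D \<sigma> = ?D s" if "\<sigma> \<in> S" for \<sigma>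
        using that s(2) degB_mono[OF emb v, of s \<sigma> a] by (auto simp: S_def intro: antisym)
      have low: "\<exists>\<alpha>\<in>A. v (a - c) < Fin \<alpha>" if "degK emb c < ?D m" for c
        using R_low[OF that] beyond by force
      have cont: "continuous_admissible_family (?M s) A ?M (?D s)"
      proof (rule continuous_res[OF emb v A(1-3)])
        show "\<exists>b. Fin \<alpha> \<le> v (a - b) \<and> degK emb b = ?D s" if "\<alpha> \<in> A" for \<alpha>
          using degB_attained[OF emb v, of \<alpha> a] D_const[of \<alpha>] that by (simp add: S)
        show "apart emb v a s (?D s)"
          unfolding apart_def
        proof (intro allI impI)
          fix c assume "degK emb c < ?D s"
          then obtain g where "v (a - c) = Fin g" "g < s" by (rule low_degree_radius[OF emb v])
          thus "v (a - c) \<le> Fin s" by (simp add: less_imp_le)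
        qed
        show "\<exists>\<alpha>\<in>A. v (a - c) < Fin \<alpha>" if "degK emb c \<le> ?D s" for c
          using low[of c] that R_less(2)[OF s(1)] by simp
      qed
      have "limit_augmented_valuation A ?M \<psi> \<epsilon> (?M m)"
        by (rule limit_augmented_res[OF emb v A(1,2,4) \<psi> b(1) \<epsilon>]) (use low b(2) in simp)
      hence tower: "has_tower \<nu> ?M (insert m (I \<union> A)) m (?D m)"
        using tower_limit[OF I(3) _ A(1) cont] A(3,4) deg by metis
      have eq: "insert m (I \<union> A) = I \<union> (S \<union> {m})" using I(1) by (auto simp: S)
      have lt: "s < m" by (rule R_less(1)[OF s(1)])
      have "descent emb v a (I \<union> (S \<union> {m})) (\<lambda>\<delta>. \<delta>) {m} (?D m)"
        using top lt A(4) by (intro descent.start) (auto simp: S intro: less_imp_le le_less_trans)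
      hence "descent emb v a (I \<union> (S \<union> {m})) (\<lambda>\<delta>. \<delta>) (S \<union> {m}) (?D s)"
      proof (rule descent.limit[OF _ nonempty up])
        show "S \<subseteq> I \<union> (S \<union> {m}) - {m}" using R_less(1) by (auto simp: S_def)
        show "\<forall>\<sigma>\<in>S. \<exists>\<tau>\<in>S. \<sigma> < \<tau>" using A(2) beyond[OF s(1)] unfolding S by auto
        show "strict_mono_on S (\<lambda>\<delta>. \<delta>)" by (simp add: strict_mono_on_def)
        show "(\<lambda>\<delta>. \<delta>) ` S \<subseteq> ?R" by (auto simp: S_def)
        show "\<forall>\<rho>\<in>?R. \<exists>\<sigma>\<in>S. \<rho> \<le> \<sigma>" using beyond by (auto simp: S intro: less_imp_le)
        show "\<forall>\<sigma>\<in>S. ?D \<sigma> = ?D s" using D_const by blast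
        show "\<forall>j\<in>I \<union> (S \<union> {m}) - {m}. \<exists>\<sigma>\<in>S. j \<le> \<sigma>" using top by (auto simp: S)
        show "\<forall>j\<in>I \<union> (S \<union> {m}). \<forall>\<sigma>\<in>S. \<sigma> \<le> j \<longrightarrow> j \<in> S \<union> {m}"
        proof (intro ballI impI)
          fix j \<sigma> assume j: "j \<in> I \<union> (S \<union> {m})" "\<sigma> \<in> S" "\<sigma> \<le> j"
          hence "s \<le> j" by (auto simp: S_def)
          hence "j \<in> I \<Longrightarrow> j = s" using top by (auto intro: antisym)
          thus "j \<in> S \<union> {m}" using j(1) S by blast
        qed
      qed
      moreover have "s \<in> S \<union> {m}" "\<forall>t\<in>S \<union> {m}. s \<le> t" 
        using lt s(1) by (auto simp: S_def less_imp_le)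
      ultimately have "descent emb v a (insert m (I \<union> A)) (\<lambda>\<delta>. \<delta>) (insert m (I \<union> A)) 1"
        using descent_glue[OF I(4,1) top] unfolding eq by blast
      moreover have "insert m (I \<union> A) \<subseteq> insert m (value_group v)"
        using I(2) R_less(3) s(1) unfolding A_def by blast
      ultimately show ?thesis using tower by blast
    qed
  qed
qed

end

theorem mainTheorem5:
  fixes emb :: "'k::field \<Rightarrow> 'l::alg_closed_field"
    and \<nu> :: "'k \<Rightarrow> 'g::linordered_ab_group_add extended"
    and \<nu>bar :: "'l \<Rightarrow> 'g extended"
    and a :: 'l and \<delta>bar :: 'g
    and \<mu>bar :: "'l poly \<Rightarrow> 'g extended"
    and \<mu> :: "'k poly \<Rightarrow> 'g extended"
  assumes "algebraic_closure_embedding emb"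
    and "henselian emb \<nu>"
    and "valuation \<nu>bar" and "extends_valuation emb \<nu> \<nu>bar"
    and "\<mu>bar = omega \<nu>bar a \<delta>bar"
    and "\<mu> = restrict_poly emb \<mu>bar"
  shows "\<exists>(I :: 'g set) (m :: 'g) (\<mu>s :: 'g \<Rightarrow> 'l poly \<Rightarrow> 'g extended) (\<delta> :: 'g \<Rightarrow> 'g).
    m \<in> I \<and> (\<forall>i\<in>I. i \<le> m) \<and> \<mu>s m = \<mu>bar \<and>
    (\<forall>i\<in>I. well_specified \<nu>bar (\<mu>s i)) \<and>
    admitted_family \<nu> I (\<lambda>i. restrict_poly emb (\<mu>s i)) \<and>
    family_associated I (\<lambda>i. restrict_poly emb (\<mu>s i)) \<mu> \<and>
    (\<forall>i\<in>I. \<mu>s i = omega \<nu>bar a (\<delta> i)) \<and> \<delta> m = \<delta>bar \<and>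
    (\<forall>i\<in>I. \<forall>j\<in>I.
       (i \<le> j \<longrightarrow> \<mu>s i \<le> \<mu>s j \<and> vball \<nu>bar a (\<delta> j) \<subseteq> vball \<nu>bar a (\<delta> i) \<and> \<delta> i \<le> \<delta> j) \<and>
       (\<mu>s i \<le> \<mu>s j \<longleftrightarrow> vball \<nu>bar a (\<delta> j) \<subseteq> vball \<nu>bar a (\<delta> i))) \<and>
    obtained_by_descent emb \<nu>bar a I \<delta>"
proof -
  note v = assms(3)
  let ?M = "\<lambda>\<delta>. restrict_poly emb (omega \<nu>bar a \<delta>)"
  from family_exists[OF assms(1,3,4), of \<delta>bar a] obtain I where
    I: "\<delta>bar \<in> I" "I \<subseteq> insert \<delta>bar (value_group \<nu>bar)" 
      "has_tower \<nu> ?M I \<delta>bar (degK_set emb (vball \<nu>bar a \<delta>bar))" 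
      "descent emb \<nu>bar a I (\<lambda>\<delta>. \<delta>) I 1"
    by blast
  have top: "i \<le> \<delta>bar" if "i \<in> I" for i using has_tower_top[OF I(3) that] .
  have mono: "omega \<nu>bar a i \<le> omega \<nu>bar a j" if "i \<le> j" for i j
    using omega_mono[OF v that] by (simp add: le_fun_def)
  have ball: "vball \<nu>bar a j \<subseteq> vball \<nu>bar a i" if "i \<le> j" for i j
    using that by (auto simp: vball_def) (meson less_eq_extended.simps(1) order_trans)
  have strict: "\<not> omega \<nu>bar a i \<le> omega \<nu>bar a j \<and> \<not> vball \<nu>bar a j \<subseteq> vball \<nu>bar a i"
    if "i \<in> I" "j \<in> I" "j < i" for i j
  proof
    have "omega \<nu>bar a i [:- a, 1:] = Fin i" "omega \<nu>bar a j [:- a, 1:] = Fin j"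
      using v by (simp_all add: omega_linear[OF v])
    thus "\<not> omega \<nu>bar a i \<le> omega \<nu>bar a j" using that(3) by (auto simp: le_fun_def not_le intro!: exI[of _ "[:- a, 1:]"])
    \<comment> \<open>A radius in the value group is attained, so the ball of radius \<open>j\<close> is really larger.\<close>
    have "j \<in> value_group \<nu>bar" using that top[of i] I(2) by auto
    then obtain x where "\<nu>bar x = Fin j" by (auto simp: value_group_def)
    hence "a - x \<in> vball \<nu>bar a j" "a - x \<notin> vball \<nu>bar a i" using that(3) by (auto simp: vball_def)
    thus "\<not> vball \<nu>bar a j \<subseteq> vball \<nu>bar a i" by blast
  qed
  have M_mono: "?M i f \<le> ?M \<delta>bar f" if "i \<in> I" for i f
    using mono[OF top[OF that]] by (simp add: restrict_poly_def le_fun_def)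
  hence greatest: "\<exists>i\<in>I. ?M \<delta>bar f = ?M i f \<and> (\<forall>j\<in>I. ?M j f \<le> ?M i f)" for f
    using I(1) by blast
  have adm: "admissible_family \<nu> I ?M"
    using tower_admissible[OF I(3)] valuation_res[OF assms(1,3)] by blast
  have "admitted_family \<nu> I ?M"
    using adm greatest unfolding admitted_family_def by blast
  moreover have "family_associated I ?M \<mu>"
    using greatest assms(5,6) unfolding family_associated_def by simp
  ultimately show ?thesis
  proof (intro exI[of _ I] exI[of _ \<delta>bar] exI[of _ "omega \<nu>bar a"] exI[of _ "\<lambda>\<delta>. \<delta>"] conjI ballI impI)
    fix i j assume ij: "i \<in> I" "j \<in> I"
    show "omega \<nu>bar a i \<le> omega \<nu>bar a j \<longleftrightarrow> vball \<nu>bar a j \<subseteq> vball \<nu>bar a i"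
      using mono[of i j] ball[of i j] strict[OF ij] by (cases "i \<le> j") auto
  qed (use I top mono ball assms(5) in
      \<open>auto simp: well_specified_def obtained_by_descent_def\<close>)
qed

end
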